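(* Let $V$ be a simple isometric linear transformation with deficiency indices $(1,1)$ in a Hilbert space, with characteristic function $w_V$. A point $z\in\mathbb{T}$ is not an eigenvalue of any unitary extension $U$ of $V$ if and only if $w_V$ does not have an angular derivative (in the sense of Carathéodory) at $z$. Moreover, the symmetric linear transformation $B=\mu^{-1}(V)$ is densely defined if and only if $w_V$ does not have an angular derivative at $z=1$.
   Context: $\mathbb{D}$ is the open unit disc, $\mathbb{T}$ the unit circle, $\mu^{-1}(V)=i(1+V)(1-V)^{-1}$ with domain $\mathrm{ran}(V-1)$ (the inverse Cayley transform). An isometric linear transformation $V$ is a linear isometry from a closed subspace $\mathrm{dom}(V)$ into the Hilbert space; deficiency indices $(\dim\mathrm{dom}(V)^\perp,\dim\mathrm{ran}(V)^\perp)$; simple = no unitary restriction to a non-trivial subspace. Its characteristic function (defined up to a unimodular constant) is $w_V(z)=\frac{z\langle (U-z)^{-1}\psi_+,\psi_+\rangle}{\langle (U-z)^{-1}U\psi_+,\psi_+\rangle}$, $z\in\mathbb{D}$, with $U$ any unitary extension of $V$ in the same Hilbert space and $0\ne\psi_+\in\mathrm{dom}(V)^\perp$; it lies in the closed unit ball of $H^\infty(\mathbb{D})$. A function $b$ in the closed unit ball of $H^\infty(\mathbb{D})$ has an angular derivative in the sense of Carathéodory at $\gamma\in\mathbb{T}$ if the non-tangential limits of $b$ and $b'$ at $\gamma$ exist and the non-tangential limit of $b$ at $\gamma$ has modulus one. *)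

theory Defs
  imports "HOL-Analysis.Analysis"
begin

text \<open>HOL-Analysis has no complex inner product spaces, so we introduce them as type classes.
  Convention: the inner product is linear in the FIRST argument and conjugate-linear in the
  second, as required by the formula for the characteristic function.\<close>

class cvector = real_vector +
  fixes scaleC :: "complex \<Rightarrow> 'a \<Rightarrow> 'a" (infixr "*\<^sub>C" 75)
  assumes scaleC_add_right: "a *\<^sub>C (x + y) = a *\<^sub>C x + a *\<^sub>C y"
    and scaleC_add_left: "(a + b) *\<^sub>C x = a *\<^sub>C x + b *\<^sub>C x"
    and scaleC_scaleC: "a *\<^sub>C (b *\<^sub>C x) = (a * b) *\<^sub>C x"
    and scaleC_one: "1 *\<^sub>C x = x"
    and scaleR_scaleC: "scaleR r x = (complex_of_real r) *\<^sub>C x"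

class complex_inner = cvector + real_normed_vector +
  fixes cinner :: "'a \<Rightarrow> 'a \<Rightarrow> complex"
  assumes cinner_commute: "cinner x y = cnj (cinner y x)"
    and cinner_add_left: "cinner (x + y) z = cinner x z + cinner y z"
    and cinner_scaleC_left: "cinner (c *\<^sub>C x) y = c * cinner x y"
    and cinner_eq_zero_iff: "cinner x x = 0 \<longleftrightarrow> x = 0"
    and cinner_ge_zero: "0 \<le> Re (cinner x x)"
    and norm_eq_sqrt_cinner: "norm x = sqrt (Re (cinner x x))"

class chilbert_space = complex_inner + complete_space

definition csubspace :: "'a::cvector set \<Rightarrow> bool" where
  "csubspace S \<longleftrightarrow> 0 \<in> S \<and> (\<forall>x\<in>S. \<forall>y\<in>S. x + y \<in> S) \<and> (\<forall>c. \<forall>x\<in>S. c *\<^sub>C x \<in> S)"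

definition closed_csubspace :: "'a::{cvector,topological_space} set \<Rightarrow> bool" where
  "closed_csubspace S \<longleftrightarrow> csubspace S \<and> closed S"

definition orth :: "'a::complex_inner set \<Rightarrow> 'a set" where
  "orth S = {y. \<forall>x\<in>S. cinner x y = 0}"

definition one_dimensional :: "'a::cvector set \<Rightarrow> bool" where
  "one_dimensional S \<longleftrightarrow> (\<exists>\<psi>. \<psi> \<noteq> 0 \<and> S = range (\<lambda>c. c *\<^sub>C \<psi>))"

text \<open>An isometric linear transformation \<open>V\<close> with domain \<open>D\<close>: a linear isometry from the
  closed subspace \<open>D\<close> into the Hilbert space (values of \<open>V\<close> outside \<open>D\<close> are irrelevant).\<close>
definition isometric_lt :: "'a::complex_inner set \<Rightarrow> ('a \<Rightarrow> 'a) \<Rightarrow> bool" where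
  "isometric_lt D V \<longleftrightarrow> closed_csubspace D \<and>
     (\<forall>x\<in>D. \<forall>y\<in>D. V (x + y) = V x + V y) \<and>
     (\<forall>c. \<forall>x\<in>D. V (c *\<^sub>C x) = c *\<^sub>C V x) \<and>
     (\<forall>x\<in>D. norm (V x) = norm x)"

definition deficiency_1_1 :: "'a::complex_inner set \<Rightarrow> ('a \<Rightarrow> 'a) \<Rightarrow> bool" where
  "deficiency_1_1 D V \<longleftrightarrow> one_dimensional (orth D) \<and> one_dimensional (orth (V ` D))"

text \<open>Simple: \<open>V\<close> has no unitary restriction to a non-trivial (closed) subspace \<open>M\<close>,
  i.e. there is no closed subspace \<open>M \<noteq> {0}\<close>, \<open>M \<subseteq> dom(V)\<close> with \<open>V(M) = M\<close>.\<close>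
definition simple_isometric :: "'a::complex_inner set \<Rightarrow> ('a \<Rightarrow> 'a) \<Rightarrow> bool" where
  "simple_isometric D V \<longleftrightarrow>
     \<not> (\<exists>M. closed_csubspace M \<and> M \<noteq> {0} \<and> M \<subseteq> D \<and> V ` M = M)"

definition unitary :: "('a::complex_inner \<Rightarrow> 'a) \<Rightarrow> bool" where
  "unitary U \<longleftrightarrow> (\<forall>x y. U (x + y) = U x + U y) \<and> (\<forall>c x. U (c *\<^sub>C x) = c *\<^sub>C U x) \<and>
     (\<forall>x. norm (U x) = norm x) \<and> surj U"

definition unitary_extension :: "('a::complex_inner \<Rightarrow> 'a) \<Rightarrow> 'a set \<Rightarrow> ('a \<Rightarrow> 'a) \<Rightarrow> bool" where
  "unitary_extension U D V \<longleftrightarrow> unitary U \<and> (\<forall>x\<in>D. U x = V x)"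

definition eigenvalue :: "('a::cvector \<Rightarrow> 'a) \<Rightarrow> complex \<Rightarrow> bool" where
  "eigenvalue U z \<longleftrightarrow> (\<exists>x. x \<noteq> 0 \<and> U x = z *\<^sub>C x)"

definition resolvent :: "('a::cvector \<Rightarrow> 'a) \<Rightarrow> complex \<Rightarrow> 'a \<Rightarrow> 'a" where
  "resolvent U z y = (THE x. U x - z *\<^sub>C x = y)"

text \<open>The characteristic function, computed from a unitary extension \<open>U\<close> and a vector
  \<open>0 \<noteq> \<psi> \<in> dom(V)^\<bottom>\<close>.\<close>
definition char_fun :: "('a::complex_inner \<Rightarrow> 'a) \<Rightarrow> 'a \<Rightarrow> complex \<Rightarrow> complex" where
  "char_fun U \<psi> z = z * cinner (resolvent U z \<psi>) \<psi> / cinner (resolvent U z (U \<psi>)) \<psi>"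

definition stolz_angle :: "complex \<Rightarrow> real \<Rightarrow> complex set" where
  "stolz_angle \<gamma> \<alpha> = {z. norm z < 1 \<and> norm (z - \<gamma>) < \<alpha> * (1 - norm z)}"

definition nt_limit :: "(complex \<Rightarrow> complex) \<Rightarrow> complex \<Rightarrow> complex \<Rightarrow> bool" where
  "nt_limit f \<gamma> L \<longleftrightarrow> (\<forall>\<alpha>>1. (f \<longlongrightarrow> L) (at \<gamma> within stolz_angle \<gamma> \<alpha>))"

definition has_angular_derivative :: "(complex \<Rightarrow> complex) \<Rightarrow> complex \<Rightarrow> bool" where
  "has_angular_derivative b \<gamma> \<longleftrightarrow>
     (\<exists>L. nt_limit b \<gamma> L \<and> norm L = 1) \<and> (\<exists>L'. nt_limit (deriv b) \<gamma> L')"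

text \<open>Graph of \<open>\<mu>^{-1}(V) = i(1+V)(1-V)^{-1}\<close>, domain \<open>ran(V - 1)\<close>:
  the pairs \<open>((1-V)x, i(1+V)x)\<close> for \<open>x \<in> dom V\<close>.\<close>
definition inv_cayley_graph :: "'a::cvector set \<Rightarrow> ('a \<Rightarrow> 'a) \<Rightarrow> ('a \<times> 'a) set" where
  "inv_cayley_graph D V = (\<lambda>x. (x - V x, \<i> *\<^sub>C (x + V x))) ` D"

definition densely_defined :: "('a::topological_space \<times> 'a) set \<Rightarrow> bool" where
  "densely_defined G \<longleftrightarrow> closure (Domain G) = UNIV"

end

theory Submission
  imports Defs
begin

text \<open>
  For \<open>z\<close> in the disc normalise the defect vector at \<open>z\<close> to the vector \<open>x\<^sub>z\<close> with
  \<open>\<langle>x\<^sub>z, \<psi>\<rangle> = \<parallel>\<psi>\<parallel>\<^sup>2\<close> and \<open>(U - z) x\<^sub>z = (1 - w(z)) U\<psi>\<close>. Since \<open>U\<close> is isometric,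
  \<open>(1 - z \<zeta>\<^sup>*) \<langle>x\<^sub>z, x\<^sub>\<zeta>\<rangle> = \<parallel>\<psi>\<parallel>\<^sup>2 (1 - w(z) w(\<zeta>)\<^sup>*)\<close>, the de Branges--Rovnyak kernel of \<open>w\<close>.
  The same equation at a boundary point \<open>\<gamma>\<close>, with a number \<open>\<kappa>\<close> in place of \<open>w(\<gamma>)\<close>, says that the
  extension sending \<open>\<psi>\<close> to \<open>\<kappa> U\<psi>\<close> has the eigenvalue \<open>\<gamma>\<close>; at \<open>\<gamma> = 1\<close> it says that the
  solution is orthogonal to the range of \<open>1 - V\<close>.

  If \<open>w\<close> has an angular derivative at \<open>\<gamma>\<close>, then \<open>\<parallel>x\<^sub>z\<parallel>\<close> stays bounded along the radius, and a
  limit of convex combinations of the \<open>x\<^sub>z\<close> solves the boundary equation. Conversely, for a boundary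
  solution \<open>x\<close> the kernel identity bounds \<open>\<parallel>x\<^sub>z\<parallel>\<close> in each Stolz angle; simplicity makes \<open>x\<close> unique,
  so \<open>x\<^sub>z\<close> tends to \<open>x\<close> weakly, and by the kernel identity in norm. Finally \<open>w'(z)\<close> is the inner
  product of \<open>x\<^sub>z\<close> with the corresponding vector for \<open>U\<^sup>-\<^sup>1\<close>, which gives the limit of \<open>w'\<close>.
\<close>

section \<open>Complex inner product spaces\<close>

interpretation scaleC: vector_space "scaleC :: complex \<Rightarrow> 'a::cvector \<Rightarrow> 'a"
  by unfold_locales (simp_all add: scaleC_add_right scaleC_add_left scaleC_scaleC scaleC_one)

section \<open>Algebra of the inner product and the Cauchy-Schwarz inequality\<close>

lemma cinner_add_right: "cinner x (y + z) = cinner x y + cinner x z"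
  by (metis cinner_add_left cinner_commute complex_cnj_add)

lemma cinner_scaleC_right: "cinner x (c *\<^sub>C y) = cnj c * cinner x y"
  by (metis cinner_commute cinner_scaleC_left complex_cnj_mult)

lemma scaleC_minus1: "(-1) *\<^sub>C x = - (x::'a::cvector)"
  by (simp add: scaleC_one)

lemma cinner_minus_left: "cinner (- x) y = - cinner x y"
  using cinner_scaleC_left[of "-1" x y] by (simp only: scaleC_minus1) simp

lemma cinner_minus_right: "cinner x (- y) = - cinner x y"
  by (metis cinner_commute cinner_minus_left complex_cnj_minus)

lemma cinner_diff_left: "cinner (x - y) z = cinner x z - cinner y z"
  using cinner_add_left[of x "-y" z] by (simp add: cinner_minus_left)

lemma cinner_diff_right: "cinner x (y - z) = cinner x y - cinner x z"
  using cinner_add_right[of x y "-z"] by (simp add: cinner_minus_right)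

lemma cinner_zero_left [simp]: "cinner 0 x = 0"
  using cinner_add_left[of 0 0 x] by simp

lemma cinner_zero_right [simp]: "cinner x 0 = 0"
  using cinner_add_right[of x 0 0] by simp

lemmas cinner_simps = cinner_add_left cinner_add_right cinner_diff_left cinner_diff_right
  cinner_scaleC_left cinner_scaleC_right cinner_minus_left cinner_minus_right

text \<open>The class axioms bound only the real part of \<open>cinner x x\<close>; conjugate
  symmetry kills the imaginary part.\<close>

lemma cinner_self: "cinner x x = of_real ((norm x)\<^sup>2)"
proof -
  have "cnj (cinner x x) = cinner x x"
    by (rule cinner_commute[symmetric])
  then have "Im (cinner x x) = 0"
    by (simp only: complex_eq_iff) simp
  moreover have "(norm x)\<^sup>2 = Re (cinner x x)"
    unfolding norm_eq_sqrt_cinner by (rule real_sqrt_pow2[OF cinner_ge_zero])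
  ultimately show ?thesis
    by (simp add: complex_eq_iff del: of_real_power)
qed

lemma cinner_eq_0_commute: "cinner x y = 0 \<longleftrightarrow> cinner y x = 0"
  by (metis cinner_commute complex_cnj_zero)

lemma norm_scaleC: "norm (c *\<^sub>C x) = cmod c * norm (x::'a::complex_inner)"
proof -
  have "complex_of_real ((norm (c *\<^sub>C x))\<^sup>2) = (c * cnj c) * of_real ((norm x)\<^sup>2)"
    unfolding cinner_self[symmetric] by (simp add: cinner_simps)
  then have "complex_of_real ((norm (c *\<^sub>C x))\<^sup>2) = of_real ((cmod c * norm x)\<^sup>2)"
    by (simp only: complex_norm_square[symmetric] power_mult_distrib of_real_mult)
  then have "(norm (c *\<^sub>C x))\<^sup>2 = (cmod c * norm x)\<^sup>2"
    by (simp only: of_real_eq_iff)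
  then show ?thesis
    by (simp add: power2_eq_iff_nonneg)
qed

lemma norm_add_sq: "(norm (x + y))\<^sup>2 = (norm x)\<^sup>2 + 2 * Re (cinner x y) + (norm y)\<^sup>2"
proof -
  have "complex_of_real ((norm (x + y))\<^sup>2) = of_real ((norm x)\<^sup>2) + (cinner x y + cnj (cinner x y)) + of_real ((norm y)\<^sup>2)"
    unfolding cinner_self[symmetric] cinner_commute[of y x, symmetric] by (simp add: cinner_simps)
  then show ?thesis
    by (simp add: complex_eq_iff del: of_real_power)
qed

lemma norm_diff_sq: "(norm (x - y))\<^sup>2 = (norm x)\<^sup>2 - 2 * Re (cinner x y) + (norm y)\<^sup>2"
  using norm_add_sq[of x "-y"] by (simp add: cinner_minus_right)

lemma parallelogram:
  "(norm (x - y))\<^sup>2 = 2 * (norm x)\<^sup>2 + 2 * (norm y)\<^sup>2 - (norm (x + y :: 'a::complex_inner))\<^sup>2"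
  by (simp add: norm_diff_sq norm_add_sq)

text \<open>Pythagoras for the component of \<open>p\<close> along \<open>s\<close>. It gives
  Cauchy-Schwarz, and later the orthogonality of a vector of minimal norm.\<close>

lemma norm_diff_projection_sq:
  assumes "s \<noteq> 0"
  shows "(norm (p - (cinner p s / of_real ((norm s)\<^sup>2)) *\<^sub>C s))\<^sup>2
    = (norm p)\<^sup>2 - (cmod (cinner p s) / norm s)\<^sup>2"
proof -
  define c where "c = cinner p s / of_real ((norm s)\<^sup>2)"
  have "Re (cinner p (c *\<^sub>C s)) = (cmod (cinner p s) / norm s)\<^sup>2"
  proof -
    have "cinner p (c *\<^sub>C s) = of_real ((cmod (cinner p s) / norm s)\<^sup>2)"
      using complex_norm_square[of "cinner p s"]
      by (simp add: c_def cinner_scaleC_right power_divide mult.commute)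
    then show ?thesis by (simp del: of_real_power)
  qed
  moreover have "(norm (c *\<^sub>C s))\<^sup>2 = (cmod (cinner p s) / norm s)\<^sup>2"
    using assms by (simp add: norm_scaleC c_def norm_divide power2_eq_square norm_mult)
  ultimately show ?thesis
    by (simp add: norm_diff_sq c_def)
qed

lemma Cauchy_Schwarz: "cmod (cinner x y) \<le> norm x * norm y"
proof (cases "y = 0")
  case False
  have "0 \<le> (norm x)\<^sup>2 - (cmod (cinner x y) / norm y)\<^sup>2"
    using norm_diff_projection_sq[OF False, of x] by (metis zero_le_power2)
  then have "(cmod (cinner x y) / norm y)\<^sup>2 \<le> (norm x)\<^sup>2" by simp
  then have "cmod (cinner x y) / norm y \<le> norm x"
    by (rule power2_le_imp_le) simp
  then show ?thesis using False by (simp add: field_simps)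
qed simp

lemma bounded_bilinear_cinner: "bounded_bilinear (cinner :: 'a::complex_inner \<Rightarrow> 'a \<Rightarrow> complex)"
proof (rule bounded_bilinear.intro)
  fix a b :: 'a and r :: real
  show "cinner (r *\<^sub>R a) b = r *\<^sub>R cinner a b"
    unfolding scaleR_scaleC[where 'a='a] cinner_scaleC_left scaleR_conv_of_real ..
  show "cinner a (r *\<^sub>R b) = r *\<^sub>R cinner a b"
    unfolding scaleR_scaleC[where 'a='a] cinner_scaleC_right scaleR_conv_of_real by simp
  show "\<exists>K. \<forall>a b :: 'a. norm (cinner a b) \<le> norm a * norm b * K"
    using Cauchy_Schwarz by (intro exI[of _ 1]) auto
qed (rule cinner_add_left cinner_add_right)+

lemma bounded_bilinear_scaleC: "bounded_bilinear (scaleC :: complex \<Rightarrow> 'a::complex_inner \<Rightarrow> 'a)"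
proof (rule bounded_bilinear.intro)
  fix a :: complex and b :: 'a and r :: real
  show "(r *\<^sub>R a) *\<^sub>C b = r *\<^sub>R (a *\<^sub>C b)"
    unfolding scaleR_scaleC[where 'a='a] scaleC_scaleC scaleR_conv_of_real ..
  show "a *\<^sub>C (r *\<^sub>R b) = r *\<^sub>R (a *\<^sub>C b)"
    unfolding scaleR_scaleC scaleC_scaleC by (simp only: mult.commute)
  show "\<exists>K. \<forall>a. \<forall>b :: 'a. norm (a *\<^sub>C b) \<le> norm a * norm b * K"
    by (intro exI[of _ 1]) (simp add: norm_scaleC)
qed (rule scaleC_add_left scaleC_add_right)+

lemmas tendsto_cinner = bounded_bilinear.tendsto[OF bounded_bilinear_cinner]
lemmas tendsto_scaleC = bounded_bilinear.tendsto[OF bounded_bilinear_scaleC]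
lemmas bounded_linear_cinner_left = bounded_bilinear.bounded_linear_left[OF bounded_bilinear_cinner]
lemmas bounded_linear_scaleC_right = bounded_bilinear.bounded_linear_right[OF bounded_bilinear_scaleC]

section \<open>Nearly norm-minimal sequences and weak limits\<close>

text \<open>The distances \<open>d n\<close> of the shrinking sets from the origin increase and are
  bounded, hence converge. Midpoints stay in the larger set by convexity, so the parallelogram law
  makes any nearly minimal choice Cauchy. The sets need not be closed, and the limit
  \<open>p\<close> need not lie in them. Constant sets yield projections, hulls of tails yield weak
  limits.\<close>

lemma near_minimal_norm_convergent:
  fixes C :: "nat \<Rightarrow> 'a::chilbert_space set"
  assumes conv: "\<And>n. convex (C n)" and dec: "decseq C"
    and B: "\<And>n. \<exists>x\<in>C n. norm x \<le> B"
  shows "\<exists>y p. (\<forall>n. y n \<in> C n) \<and> y \<longlonglongrightarrow> p \<and>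
    (\<forall>n. \<forall>c\<in>C n. norm (y n) \<le> norm c + inverse (real (Suc n)))"
proof -
  define d where "d n = Inf (norm ` C n)" for n
  define e where "e n = inverse (real (Suc n))" for n
  have bdd: "bdd_below (norm ` C n)" for n
    by (rule bdd_belowI2[of _ 0]) simp
  have ne: "norm ` C n \<noteq> {}" for n using B[of n] by auto
  have d_le: "d n \<le> norm c" if "c \<in> C n" for n c
    unfolding d_def using bdd that by (intro cInf_lower) auto
  have d0: "0 \<le> d n" for n
    unfolding d_def using ne by (intro cInf_greatest) auto
  have epos: "e n > 0" for n by (simp add: e_def)
  have "\<exists>y\<in>C n. norm y < d n + e n" for n
  proof -
    have "Inf (norm ` C n) < d n + e n" using epos[of n] by (simp add: d_def)
    then show ?thesis using cInf_less_iff[OF ne bdd] by auto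
  qed
  then obtain y where y: "y n \<in> C n" "norm (y n) < d n + e n" for n
    by metis
  have inc: "incseq d"
    unfolding d_def incseq_def
  proof (intro allI impI)
    fix m n :: nat assume "m \<le> n"
    then have "C n \<subseteq> C m" using dec by (auto simp: decseq_def)
    then show "Inf (norm ` C m) \<le> Inf (norm ` C n)"
      by (intro cInf_superset_mono ne bdd) auto
  qed
  have dB: "d n \<le> B" for n using B[of n] d_le by (meson order_trans)
  obtain L where L: "d \<longlonglongrightarrow> L" "\<And>n. d n \<le> L"
    using incseq_convergent[OF inc, of B] dB by blast
  have e_lim: "e \<longlonglongrightarrow> 0"
    unfolding e_def by (rule LIMSEQ_inverse_real_of_nat)
  \<comment> \<open>The parallelogram bound for two vectors of norm at most \<open>L + e n\<close>
    whose midpoint has norm at least \<open>d n\<close>.\<close>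
  define g where "g n = 4 * (L + e n)\<^sup>2 - 4 * (d n)\<^sup>2" for n
  have g_lim: "g \<longlonglongrightarrow> 0"
  proof -
    have "g \<longlonglongrightarrow> 4 * (L + 0)\<^sup>2 - 4 * L\<^sup>2"
      unfolding g_def by (intro tendsto_intros e_lim L)
    then show ?thesis by simp
  qed
  have key: "(norm (y n - y m))\<^sup>2 \<le> g n" if "n \<le> m" for n m
  proof -
    have "C m \<subseteq> C n" using dec that by (auto simp: decseq_def)
    then have "y m \<in> C n" using y by auto
    then have "(1/2) *\<^sub>R y n + (1/2) *\<^sub>R y m \<in> C n"
      using conv[of n] y(1)[of n] by (intro convexD) auto
    then have "d n \<le> norm ((1/2) *\<^sub>R y n + (1/2) *\<^sub>R y m)" by (rule d_le)
    also have "\<dots> = norm (y n + y m) / 2"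
      by (simp add: scaleR_add_right[symmetric])
    finally have "2 * d n \<le> norm (y n + y m)" by simp
    then have 1: "(2 * d n)\<^sup>2 \<le> (norm (y n + y m))\<^sup>2"
      using d0[of n] by (intro power_mono) auto
    have em: "e m \<le> e n" using that by (simp add: e_def field_simps)
    have 2: "norm (y n) \<le> L + e n" "norm (y m) \<le> L + e n"
      using y(2)[of n] y(2)[of m] L(2)[of n] L(2)[of m] em by linarith+
    have "(norm (y n))\<^sup>2 \<le> (L + e n)\<^sup>2" "(norm (y m))\<^sup>2 \<le> (L + e n)\<^sup>2"
      using 2 by (auto intro: power_mono)
    then show ?thesis
      using 1 unfolding parallelogram g_def by (simp add: power_mult_distrib)
  qed
  have "Cauchy y"
  proof (rule CauchyI')
    fix \<epsilon> :: real assume "\<epsilon> > 0"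
    then have "\<forall>\<^sub>F n in sequentially. g n < \<epsilon>\<^sup>2"
      using g_lim by (intro order_tendstoD) auto
    then obtain M where M: "\<And>n. n \<ge> M \<Longrightarrow> g n < \<epsilon>\<^sup>2"
      by (auto simp: eventually_sequentially)
    show "\<exists>M. \<forall>m\<ge>M. \<forall>n>m. dist (y m) (y n) < \<epsilon>"
    proof (intro exI allI impI)
      fix m n assume "M \<le> m" "m < n"
      then have "(norm (y m - y n))\<^sup>2 < \<epsilon>\<^sup>2"
        using key[of m n] M[of m] by linarith
      then show "dist (y m) (y n) < \<epsilon>"
        using \<open>\<epsilon> > 0\<close> by (simp add: power2_less_imp_less dist_norm)
    qed
  qed
  then obtain p where "y \<longlonglongrightarrow> p"
    by (auto simp: Cauchy_convergent_iff convergent_def)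
  moreover have "norm (y n) \<le> norm c + inverse (real (Suc n))" if "c \<in> C n" for n c
    using y(2)[of n] d_le[OF that] by (simp add: e_def)
  ultimately show ?thesis using y(1) by blast
qed

text \<open>Mazur's lemma in place of weak sequential compactness: the limit of nearly norm-minimal
  convex combinations of the tails.\<close>

lemma bounded_sequence_weak_point:
  fixes s :: "nat \<Rightarrow> 'a::chilbert_space" and T :: "'a \<Rightarrow> 'b::real_normed_vector"
  assumes T: "bounded_linear T" and s: "bounded (range s)" and l: "(\<lambda>n. T (s n)) \<longlonglongrightarrow> l"
  obtains p where "T p = l"
proof -
  obtain B where B: "\<And>n. norm (s n) \<le> B"
    using s by (auto simp: bounded_iff)
  let ?C = "\<lambda>n. convex hull (s ` {n..})"
  have dec: "decseq ?C"
    unfolding decseq_def by (intro allI impI hull_mono image_mono) auto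
  have ex: "\<exists>x\<in>?C n. norm x \<le> B" for n
    using B[of n] by (intro bexI[of _ "s n"]) (auto intro: hull_inc)
  obtain y p where y: "\<And>n. y n \<in> ?C n" "y \<longlonglongrightarrow> p"
    using near_minimal_norm_convergent[OF convex_convex_hull dec ex] by blast
  have "(\<lambda>n. T (y n)) \<longlonglongrightarrow> l"
  proof (rule metric_LIMSEQ_I)
    fix \<epsilon> :: real assume "\<epsilon> > 0"
    then obtain M where M: "\<And>n. n \<ge> M \<Longrightarrow> dist (T (s n)) l < \<epsilon>"
      using metric_LIMSEQ_D[OF l] by blast
    have "dist (T (y n)) l < \<epsilon>" if "n \<ge> M" for n
    proof -
      have "convex (T -` ball l \<epsilon>)"
        using T by (intro convex_linear_vimage) (auto simp: bounded_linear.linear)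
      moreover have "s ` {n..} \<subseteq> T -` ball l \<epsilon>"
        using M that by (auto simp: dist_commute)
      ultimately have "?C n \<subseteq> T -` ball l \<epsilon>"
        by (rule hull_minimal[rotated])
      then show ?thesis using y(1)[of n] by (auto simp: dist_commute)
    qed
    then show "\<exists>no. \<forall>n\<ge>no. dist (T (y n)) l < \<epsilon>" by blast
  qed
  moreover have "(\<lambda>n. T (y n)) \<longlonglongrightarrow> T p"
    using T y(2) by (rule bounded_linear.tendsto)
  ultimately show thesis using that LIMSEQ_unique by blast
qed

text \<open>Otherwise a subsequence keeps \<open>f (s n)\<close> away from \<open>f p\<close>, while
  a further one makes these numbers converge to some \<open>c\<close>. A weak point for the pair of
  \<open>T\<close> and \<open>f\<close> is one vector \<open>x\<close> with \<open>T x = T p\<close>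
  and \<open>f x = c\<close>; injectivity at \<open>p\<close> gives \<open>c = f p\<close>, a
  contradiction.\<close>

lemma bounded_sequence_weak_limit:
  fixes s :: "nat \<Rightarrow> 'a::chilbert_space" and T :: "'a \<Rightarrow> 'b::real_normed_vector"
    and f :: "'a \<Rightarrow> complex"
  assumes T: "bounded_linear T" and inj: "\<And>x. T x = T p \<Longrightarrow> x = p"
    and f: "bounded_linear f"
    and s: "bounded (range s)" and l: "(\<lambda>n. T (s n)) \<longlonglongrightarrow> T p"
  shows "(\<lambda>n. f (s n)) \<longlonglongrightarrow> f p"
proof (rule ccontr)
  assume "\<not> ?thesis"
  then obtain \<epsilon> where \<epsilon>: "\<epsilon> > 0" "\<And>M. \<exists>n\<ge>M. dist (f (s n)) (f p) \<ge> \<epsilon>"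
    unfolding lim_sequentially by (meson not_less)
  obtain r :: "nat \<Rightarrow> nat" where r: "strict_mono r" "\<And>n. dist (f (s (r n))) (f p) \<ge> \<epsilon>"
    using infinite_enumerate[of "{n. dist (f (s n)) (f p) \<ge> \<epsilon>}"] \<epsilon>(2)
    by (auto simp: infinite_nat_iff_unbounded_le)
  have "bounded (range (\<lambda>n. f (s (r n))))"
    by (rule bounded_subset[OF bounded_linear_image[OF s f]]) auto
  then obtain c q where q: "strict_mono q" "((\<lambda>n. f (s (r n))) \<circ> q) \<longlonglongrightarrow> c"
    using bounded_imp_convergent_subsequence by blast
  let ?t = "\<lambda>n. s (r (q n))"
  have "(\<lambda>n. T (?t n)) \<longlonglongrightarrow> T p"
    using LIMSEQ_subseq_LIMSEQ[OF l strict_mono_o[OF r(1) q(1)]] by (simp add: o_def)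
  then have "(\<lambda>n. (T (?t n), f (?t n))) \<longlonglongrightarrow> (T p, c)"
    using q(2) by (intro tendsto_Pair) (auto simp: o_def)
  moreover have "bounded (range ?t)"
    by (rule bounded_subset[OF s]) auto
  ultimately obtain x where "(T x, f x) = (T p, c)"
    using bounded_sequence_weak_point[of "\<lambda>x. (T x, f x)"] T f bounded_linear_Pair by blast
  then have "f p = c" using inj[of x] by auto
  then have "(\<lambda>n. dist (f (?t n)) (f p)) \<longlonglongrightarrow> 0"
    using q(2) tendsto_dist_iff[of "\<lambda>n. f (?t n)" c sequentially] by (simp add: o_def)
  then have "\<epsilon> \<le> 0"
    using r(2) by (intro LIMSEQ_le_const[of _ 0]) blast+
  then show False using \<epsilon>(1) by simp
qed

section \<open>Orthogonal projection onto the closure of a subspace\<close>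

lemma csubspace_convex:
  assumes "csubspace S"
  shows "convex S"
  unfolding convex_def scaleR_scaleC using assms by (simp add: csubspace_def)

text \<open>The limit \<open>p\<close> of nearly shortest vectors in \<open>y + S\<close> cannot be
  shortened by subtracting a multiple of some \<open>s\<close> in \<open>S\<close>, so it is
  orthogonal to \<open>S\<close>. As \<open>S\<close> may fail to be closed, the projection
  \<open>y - p\<close> is only located in its closure.\<close>

lemma csubspace_projection:
  fixes S :: "'a::chilbert_space set"
  assumes S: "csubspace S"
  obtains q where "q \<in> closure S" "y - q \<in> orth S"
proof -
  let ?C = "(\<lambda>s. y + s) ` S"
  have 0: "0 \<in> S" using S by (simp add: csubspace_def)
  have conv: "convex ?C" using csubspace_convex[OF S] by (rule convex_translation)
  have ex: "\<exists>x\<in>?C. norm x \<le> norm y"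
    using 0 by (intro bexI[of _ y]) (auto intro!: image_eqI[of _ _ 0])
  obtain u p where u: "\<And>n. u n \<in> ?C" "u \<longlonglongrightarrow> p"
    "\<And>n c. c \<in> ?C \<Longrightarrow> norm (u n) \<le> norm c + inverse (real (Suc n))"
    using near_minimal_norm_convergent[OF conv decseq_const ex] by blast
  have "y - p \<in> closure S"
  proof -
    have m: "csubspace S \<Longrightarrow> x \<in> S \<Longrightarrow> - x \<in> S" for x
      by (metis csubspace_def scaleC_minus1)
    have "y - u n \<in> S" for n using u(1)[of n] m[OF S] by auto
    moreover have "(\<lambda>n. y - u n) \<longlonglongrightarrow> y - p" by (intro tendsto_intros u)
    ultimately show ?thesis
      unfolding closure_sequential by (intro exI[of _ "\<lambda>n. y - u n"]) auto
  qed
  moreover have "cinner s p = 0" if s: "s \<in> S" for s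
  proof (cases "s = 0")
    case False
    \<comment> \<open>The coefficient of the component of \<open>p\<close> along \<open>s\<close>.
      Removing it from \<open>u n\<close> stays in \<open>?C\<close>, so in the limit it cannot
      shorten \<open>p\<close>.\<close>
    define c where "c = cinner p s / of_real ((norm s)\<^sup>2)"
    have "u n - c *\<^sub>C s \<in> ?C" for n
    proof -
      obtain t where "t \<in> S" "u n = y + t" using u(1)[of n] by auto
      moreover have "t + (-c) *\<^sub>C s \<in> S" using S \<open>t \<in> S\<close> s by (simp only: csubspace_def)
      ultimately show ?thesis by (auto intro!: image_eqI[of _ _ "t + (-c) *\<^sub>C s"])
    qed
    then have le: "norm (u n) \<le> norm (u n - c *\<^sub>C s) + inverse (real (Suc n))" for n
      using u(3) by blast
    have "(\<lambda>n. norm (u n - c *\<^sub>C s) + inverse (real (Suc n))) \<longlonglongrightarrow> norm (p - c *\<^sub>C s) + 0"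
      by (intro tendsto_intros u LIMSEQ_inverse_real_of_nat)
    moreover have "(\<lambda>n. norm (u n)) \<longlonglongrightarrow> norm p" by (intro tendsto_intros u)
    ultimately have "norm p \<le> norm (p - c *\<^sub>C s)"
      using le by (intro LIMSEQ_le[of "\<lambda>n. norm (u n)"]) auto
    then have "(norm p)\<^sup>2 \<le> (norm (p - c *\<^sub>C s))\<^sup>2" by (simp add: power_mono)
    then have "(cmod (cinner p s) / norm s)\<^sup>2 \<le> 0"
      unfolding c_def norm_diff_projection_sq[OF False] by simp
    then show ?thesis using False cinner_eq_0_commute[of s p] by simp
  qed simp
  ultimately show thesis using that[of "y - p"] by (simp add: orth_def)
qed

section \<open>Solutions of the defect equation\<close>

lemma
  assumes "unitary U"
  shows unitary_add: "U (x + y) = U x + U y"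
    and unitary_scaleC: "U (c *\<^sub>C x) = c *\<^sub>C U x"
    and unitary_norm: "norm (U x) = norm x"
    and unitary_surj: "surj U"
  using assms by (simp_all add: unitary_def)

lemma unitary_minus: "unitary U \<Longrightarrow> U (- x) = - U x"
  using unitary_scaleC[of U "-1" x] by (simp only: scaleC_minus1)

lemma unitary_diff: "unitary U \<Longrightarrow> U (x - y) = U x - U y"
  using unitary_add[of U x "-y"] by (simp add: unitary_minus)

lemma unitary_inj:
  assumes U: "unitary U"
  shows "inj U"
proof (rule injI)
  fix x y assume "U x = U y"
  then show "x = y"
    using unitary_norm[OF U, of "x - y"] by (simp add: unitary_diff[OF U])
qed

lemma unitary_inverse: "unitary U \<Longrightarrow> U (inv U x) = x" "unitary U \<Longrightarrow> inv U (U x) = x"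
  by (simp_all add: surj_f_inv_f unitary_surj inv_f_f unitary_inj)

text \<open>Polarisation: norms determine the real part of the inner product, and replacing
  \<open>y\<close> by \<open>\<i> *\<^sub>C y\<close> recovers the imaginary part.\<close>

lemma unitary_cinner:
  assumes "unitary U"
  shows "cinner (U x) (U y) = cinner x y"
proof -
  have Re_eq: "Re (cinner (U x) (U y)) = Re (cinner x y)" for x y
    using norm_add_sq[of x y] norm_add_sq[of "U x" "U y"]
    by (simp add: unitary_norm[OF assms] flip: unitary_add[OF assms])
  have "Im (cinner (U x) (U y)) = Im (cinner x y)"
    using Re_eq[of x "\<i> *\<^sub>C y"] by (simp add: unitary_scaleC[OF assms] cinner_scaleC_right)
  then show ?thesis
    using Re_eq by (simp add: complex_eq_iff)
qed

lemma unitary_inv: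
  assumes U: "unitary U"
  shows "unitary (inv U)"
  unfolding unitary_def
proof (intro conjI allI)
  show "surj (inv U)"
    using unitary_inj[OF U] by (rule inj_imp_surj_inv)
next
  fix x show "norm (inv U x) = norm x"
    using unitary_norm[OF U, of "inv U x"] by (simp add: unitary_inverse[OF U])
next
  fix x y show "inv U (x + y) = inv U x + inv U y"
    by (rule injD[OF unitary_inj[OF U]]) (simp add: unitary_add[OF U] unitary_inverse[OF U])
next
  fix c x show "inv U (c *\<^sub>C x) = c *\<^sub>C inv U x"
    by (rule injD[OF unitary_inj[OF U]]) (simp add: unitary_scaleC[OF U] unitary_inverse[OF U])
qed

lemma unitary_bounded_linear:
  assumes U: "unitary U"
  shows "bounded_linear U"
proof (rule bounded_linear_intro[of _ 1])
  show "U (r *\<^sub>R x) = r *\<^sub>R U x" for r x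
    unfolding scaleR_scaleC by (rule unitary_scaleC[OF U])
qed (simp_all add: unitary_add[OF U] unitary_norm[OF U])

text \<open>The solution is the fixed point of a contraction with constant
  \<open>cmod z\<close>.\<close>

lemma unitary_Neumann:
  fixes T :: "'a::chilbert_space \<Rightarrow> 'a"
  assumes T: "unitary T" and z: "cmod z < 1"
  shows "\<exists>x. x - z *\<^sub>C T x = y"
proof -
  have "\<exists>!x. y + z *\<^sub>C T x = x"
  proof (rule banach_fix_type[of "cmod z"])
    show "\<forall>x x'. dist (y + z *\<^sub>C T x) (y + z *\<^sub>C T x') \<le> cmod z * dist x x'"
      by (simp add: dist_norm norm_scaleC unitary_norm[OF T]
          flip: scaleC.scale_right_diff_distrib unitary_diff[OF T])
  qed (use z in auto)
  then show ?thesis by (metis add_diff_cancel_right')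
qed

lemma unitary_no_eigenvector:
  assumes U: "unitary U" and z: "cmod z < 1" and x: "U x = z *\<^sub>C x"
  shows "x = 0"
proof -
  have "norm x = cmod z * norm x"
    by (metis U unitary_norm x norm_scaleC)
  then show ?thesis using z by auto
qed

text \<open>The definite description is justified in two steps: \<open>U - z\<close> is onto because
  \<open>1 - z U\<^sup>-\<^sup>1\<close> is, and injective because a unitary operator has no
  eigenvalue in the open disc.\<close>

lemma resolvent_eq:
  fixes U :: "'a::chilbert_space \<Rightarrow> 'a"
  assumes U: "unitary U" and z: "cmod z < 1"
  shows "U (resolvent U z y) - z *\<^sub>C resolvent U z y = y"
proof -
  have "\<exists>!x. U x - z *\<^sub>C x = y"
  proof (rule ex_ex1I)
    obtain x where "x - z *\<^sub>C inv U x = y"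
      using unitary_Neumann[OF unitary_inv[OF U] z] by blast
    then have "U (inv U x) - z *\<^sub>C inv U x = y"
      by (simp add: unitary_inverse[OF U])
    then show "\<exists>x. U x - z *\<^sub>C x = y" by blast
  next
    fix x x' assume "U x - z *\<^sub>C x = y" "U x' - z *\<^sub>C x' = y"
    then have "U (x - x') = z *\<^sub>C (x - x')"
      by (simp add: unitary_diff[OF U] scaleC.scale_right_diff_distrib algebra_simps)
    then show "x = x'"
      using unitary_no_eigenvector[OF U z, of "x - x'"] by simp
  qed
  then show ?thesis
    unfolding resolvent_def by (rule theI')
qed

text \<open>Since \<open>x - \<psi>\<close> is orthogonal to \<open>\<psi>\<close>, the second
  condition says that \<open>z *\<^sub>C x\<close> is the image of \<open>x\<close> under the
  operator that agrees with \<open>U\<close> on the orthogonal complement of \<open>\<psi>\<close>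
  and sends \<open>\<psi>\<close> to \<open>w *\<^sub>C U \<psi>\<close>. This reading serves the
  disc and the circle alike.\<close>

definition defect_solution :: "('a::complex_inner \<Rightarrow> 'a) \<Rightarrow> 'a \<Rightarrow> complex \<Rightarrow> complex \<Rightarrow> 'a \<Rightarrow> bool" where
  "defect_solution U \<psi> z w x \<longleftrightarrow>
     cinner x \<psi> = cinner \<psi> \<psi> \<and> U x = z *\<^sub>C x + (1 - w) *\<^sub>C U \<psi>"

text \<open>\<open>U\<close> maps \<open>x - (1 - w) \<psi>\<close> to \<open>z x\<close>, and
  likewise for \<open>y\<close>. Comparing the two inner products, which are equal because
  \<open>U\<close> is isometric, gives the identity.\<close>

lemma defect_solution_kernel:
  assumes U: "unitary U" and x: "defect_solution U \<psi> z w x" and y: "defect_solution U \<psi> z' w' y"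
  shows "(1 - z * cnj z') * cinner x y = cinner \<psi> \<psi> * (1 - w * cnj w')"
proof -
  have "U (x - (1 - w) *\<^sub>C \<psi>) = z *\<^sub>C x" "U (y - (1 - w') *\<^sub>C \<psi>) = z' *\<^sub>C y"
    using x y by (simp_all add: defect_solution_def unitary_diff[OF U] unitary_scaleC[OF U])
  then have "cinner (x - (1 - w) *\<^sub>C \<psi>) (y - (1 - w') *\<^sub>C \<psi>) = cinner (z *\<^sub>C x) (z' *\<^sub>C y)"
    by (metis unitary_cinner[OF U])
  moreover have "cinner x \<psi> = cinner \<psi> \<psi>" "cinner \<psi> y = cinner \<psi> \<psi>"
    using x y by (simp add: defect_solution_def, metis cinner_commute defect_solution_def)
  ultimately show ?thesis
    by (simp add: cinner_simps) (simp add: algebra_simps)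
qed

lemma defect_solution_norm:
  assumes "unitary U" and "defect_solution U \<psi> z w x"
  shows "(1 - (cmod z)\<^sup>2) * (norm x)\<^sup>2 = (norm \<psi>)\<^sup>2 * (1 - (cmod w)\<^sup>2)"
proof -
  have "complex_of_real ((1 - (cmod z)\<^sup>2) * (norm x)\<^sup>2) = of_real ((norm \<psi>)\<^sup>2 * (1 - (cmod w)\<^sup>2))"
    using defect_solution_kernel[OF assms(1) assms(2) assms(2)]
    by (simp add: cinner_self flip: complex_norm_square)
  then show ?thesis by (simp only: of_real_eq_iff)
qed

text \<open>Evaluate \<open>cinner (U x) v\<close> directly and after moving \<open>U\<close> to the
  other side as its inverse. For distinct points this is a difference quotient of \<open>w\<close>;
  for equal points it identifies \<open>w'\<close> with the conjugate of \<open>w\<close>.\<close>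

lemma defect_solution_pairing:
  assumes U: "unitary U" and x: "defect_solution U \<psi> \<zeta> w x"
    and v: "defect_solution (inv U) (U \<psi>) (cnj z) w' v"
  shows "(\<zeta> - z) * cinner x v = (w - cnj w') * cinner \<psi> \<psi>"
proof -
  have v1: "cinner v (U \<psi>) = cinner \<psi> \<psi>"
    using v by (simp add: defect_solution_def unitary_cinner[OF U])
  have v2: "inv U v = cnj z *\<^sub>C v + (1 - w') *\<^sub>C \<psi>"
    using v by (simp add: defect_solution_def unitary_inverse[OF U])
  have "cinner (U x) v = cinner x (inv U v)"
    by (metis U unitary_cinner unitary_inverse(1))
  moreover have "cinner (U \<psi>) v = cinner \<psi> \<psi>"
    by (metis v1 cinner_commute)
  ultimately show ?thesis
    using x unfolding v2 defect_solution_def by (simp add: cinner_simps) (simp add: algebra_simps)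
qed

text \<open>The solution is a multiple of \<open>k\<close>, the resolvent applied to
  \<open>U \<psi>\<close>. Because \<open>k = U g\<close>, the numerator
  \<open>z * cinner g \<psi>\<close> of the characteristic function is
  \<open>cinner k \<psi> - cinner \<psi> \<psi>\<close>, so \<open>1 - char_fun U \<psi> z\<close>
  is exactly the factor that normalises \<open>k\<close>.\<close>

lemma defect_solution_char_fun:
  fixes U :: "'a::chilbert_space \<Rightarrow> 'a"
  assumes U: "unitary U" and z: "cmod z < 1" and \<psi>: "\<psi> \<noteq> 0"
  shows "\<exists>x. defect_solution U \<psi> z (char_fun U \<psi> z) x"
proof -
  define g where "g = resolvent U z \<psi>"
  define k where "k = resolvent U z (U \<psi>)"
  have g: "U g = z *\<^sub>C g + \<psi>" and k: "U k = z *\<^sub>C k + U \<psi>"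
    using resolvent_eq[OF U z, of \<psi>] resolvent_eq[OF U z, of "U \<psi>"]
    by (simp_all add: g_def k_def algebra_simps)
  \<comment> \<open>Both \<open>k\<close> and \<open>U g\<close> are preimages of
    \<open>U \<psi>\<close> under \<open>U - z\<close>, so their difference would be an
    eigenvector.\<close>
  have "U (k - U g) = z *\<^sub>C (k - U g)"
  proof -
    have "U (U g) = z *\<^sub>C U g + U \<psi>"
      by (metis g U unitary_add unitary_scaleC)
    then show ?thesis
      by (simp add: unitary_diff[OF U] k scaleC.scale_right_diff_distrib)
  qed
  then have "k = U g"
    using unitary_no_eigenvector[OF U z, of "k - U g"] by simp
  then have kg: "cinner k \<psi> = z * cinner g \<psi> + cinner \<psi> \<psi>"
    by (simp add: g cinner_simps)
  \<comment> \<open>If \<open>k\<close> were orthogonal to \<open>\<psi>\<close>, then by Pythagoras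
    \<open>k - \<psi>\<close> would be longer than \<open>k\<close>, although \<open>U\<close> maps
    it to \<open>z *\<^sub>C k\<close>.\<close>
  have k0: "cinner k \<psi> \<noteq> 0"
  proof
    assume 0: "cinner k \<psi> = 0"
    have "U (k - \<psi>) = z *\<^sub>C k"
      by (simp add: unitary_diff[OF U] k)
    then have "norm (k - \<psi>) = cmod z * norm k"
      by (metis U unitary_norm norm_scaleC)
    then have "(norm k)\<^sup>2 + (norm \<psi>)\<^sup>2 = (cmod z * norm k)\<^sup>2"
      using norm_diff_sq[of k \<psi>] 0 by simp
    moreover have "(cmod z * norm k)\<^sup>2 \<le> (norm k)\<^sup>2"
      using z by (intro power_mono) (auto intro: mult_left_le_one_le)
    moreover have "(norm \<psi>)\<^sup>2 > 0" using \<psi> by simp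
    ultimately show False by linarith
  qed
  have w: "1 - char_fun U \<psi> z = cinner \<psi> \<psi> / cinner k \<psi>"
    using k0 by (simp add: char_fun_def flip: g_def k_def) (simp add: kg field_simps)
  have "defect_solution U \<psi> z (char_fun U \<psi> z) ((cinner \<psi> \<psi> / cinner k \<psi>) *\<^sub>C k)"
    unfolding defect_solution_def w using k0
    by (simp add: cinner_scaleC_left unitary_scaleC[OF U] k scaleC_add_right scaleC_scaleC mult.commute)
  then show ?thesis by blast
qed

section \<open>The kernel in the disc\<close>

text \<open>Converts the distance of \<open>w\<close> from a boundary value into a bound for the
  right-hand side of the norm identity.\<close>

lemma one_minus_norm_sq_le:
  assumes "cmod \<kappa> = 1"
  shows "1 - (cmod w)\<^sup>2 \<le> 2 * cmod (\<kappa> - w)"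
proof -
  have "1 - (cmod w)\<^sup>2 \<le> 2 * (1 - cmod w)"
    using zero_le_power2[of "1 - cmod w"] by (simp add: power2_diff)
  also have "1 - cmod w \<le> cmod (\<kappa> - w)"
    using norm_triangle_ineq2[of \<kappa> w] assms by simp
  finally show ?thesis by simp
qed

lemma cmod_unit_mult_cnj: "cmod c = 1 \<Longrightarrow> c * cnj c = 1"
  by (simp flip: complex_norm_square)

lemma cmod_one_minus_mult_cnj:
  assumes "cmod c = 1"
  shows "cmod (1 - z * cnj c) = cmod (c - z)"
proof -
  have "1 - z * cnj c = (c - z) * cnj c"
    using cmod_unit_mult_cnj[OF assms] by (simp add: left_diff_distrib)
  then show ?thesis using assms by (simp add: norm_mult)
qed

text \<open>Expanding the squared norm of \<open>f t - x\<close> involves only the norm of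
  \<open>f t\<close> and its inner product with \<open>x\<close> itself.\<close>

lemma tendsto_of_norm_cinner:
  fixes f :: "'b \<Rightarrow> 'a::complex_inner"
  assumes "((\<lambda>t. (norm (f t))\<^sup>2) \<longlongrightarrow> (norm x)\<^sup>2) F"
    and "((\<lambda>t. cinner (f t) x) \<longlongrightarrow> cinner x x) F"
  shows "(f \<longlongrightarrow> x) F"
proof -
  have "((\<lambda>t. sqrt ((norm (f t))\<^sup>2 - 2 * Re (cinner (f t) x) + (norm x)\<^sup>2)) \<longlongrightarrow>
      sqrt ((norm x)\<^sup>2 - 2 * Re (cinner x x) + (norm x)\<^sup>2)) F"
    by (intro tendsto_intros assms)
  then have "((\<lambda>t. norm (f t - x)) \<longlongrightarrow> 0) F"
    by (simp add: cinner_self flip: norm_diff_sq)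
  then show ?thesis
    by (rule LIM_zero_cancel[OF tendsto_norm_zero_cancel])
qed

lemma eventually_in_stolz: "\<forall>\<^sub>F z in at \<gamma> within stolz_angle \<gamma> \<alpha>. z \<in> stolz_angle \<gamma> \<alpha>"
  by (simp add: eventually_at_filter)

text \<open>\<open>Y\<close> is the family belonging to the inverse operator, taken at conjugate
  points, where the value of its characteristic function is the conjugate of \<open>w z\<close>.
  Pairing \<open>X\<close> with \<open>Y\<close> produces difference quotients of
  \<open>w\<close>.\<close>

locale characteristic_family =
  fixes U :: "'a::chilbert_space \<Rightarrow> 'a" and \<psi> :: 'a and w :: "complex \<Rightarrow> complex"
    and X Y :: "complex \<Rightarrow> 'a"
  assumes U: "unitary U" and \<psi>: "\<psi> \<noteq> 0"
    and X: "\<And>z. cmod z < 1 \<Longrightarrow> defect_solution U \<psi> z (w z) (X z)"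
    and Y: "\<And>z. cmod z < 1 \<Longrightarrow> defect_solution (inv U) (U \<psi>) (cnj z) (cnj (w z)) (Y z)"
begin

abbreviation "N \<equiv> cinner \<psi> \<psi>"

lemma N_nonzero: "N \<noteq> 0"
  using \<psi> by (simp add: cinner_eq_zero_iff)

lemma norm_X: "cmod z < 1 \<Longrightarrow> (1 - (cmod z)\<^sup>2) * (norm (X z))\<^sup>2 = (norm \<psi>)\<^sup>2 * (1 - (cmod (w z))\<^sup>2)"
  using defect_solution_norm[OF U X] .

lemma disc_square: "cmod z < 1 \<Longrightarrow> 0 < 1 - (cmod z)\<^sup>2"
  by (simp add: power_less_one_iff)

lemma norm_X_divide:
  "cmod z < 1 \<Longrightarrow> (norm (X z))\<^sup>2 = (norm \<psi>)\<^sup>2 * (1 - (cmod (w z))\<^sup>2) / (1 - (cmod z)\<^sup>2)"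
  using norm_X[of z] disc_square[of z] by (simp add: field_simps)

lemma norm_Y:
  assumes z: "cmod z < 1"
  shows "norm (Y z) = norm (X z)"
proof -
  have "(1 - (cmod z)\<^sup>2) * (norm (Y z))\<^sup>2 = (1 - (cmod z)\<^sup>2) * (norm (X z))\<^sup>2"
    using defect_solution_norm[OF unitary_inv[OF U] Y[OF z]] norm_X[OF z]
    by (simp add: unitary_norm[OF U])
  then show ?thesis
    using disc_square[OF z] by (simp add: power2_eq_iff_nonneg)
qed

section \<open>Continuity and complex derivative of the characteristic function in the disc\<close>

lemma w_diff:
  assumes "defect_solution U \<psi> \<zeta> \<omega> x" and "cmod z < 1"
  shows "(\<zeta> - z) * cinner x (Y z) = (\<omega> - w z) * N"
  using defect_solution_pairing[OF U assms(1) Y[OF assms(2)]] by simp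

lemma eventually_disc: "cmod z < 1 \<Longrightarrow> \<forall>\<^sub>F \<zeta> in at z. cmod \<zeta> < 1"
  by (intro order_tendstoD(2)[of cmod "cmod z"] tendsto_intros)

text \<open>By \<open>w_diff\<close> the increment of \<open>w\<close> is \<open>\<zeta> - z\<close>
  times an inner product with \<open>X \<zeta>\<close>, and the norm identity bounds
  \<open>X \<zeta>\<close> locally, whatever the value of \<open>w \<zeta>\<close>.\<close>

lemma w_tendsto:
  assumes z: "cmod z < 1"
  shows "(w \<longlongrightarrow> w z) (at z)"
proof -
  have "((\<lambda>\<zeta>. cmod (\<zeta> - z) * (norm \<psi> / sqrt (1 - (cmod \<zeta>)\<^sup>2)) * norm (Y z) / cmod N) \<longlongrightarrow>
      cmod (z - z) * (norm \<psi> / sqrt (1 - (cmod z)\<^sup>2)) * norm (Y z) / cmod N) (at z)"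
    using disc_square[OF z] N_nonzero by (intro tendsto_intros) auto
  then have lim: "((\<lambda>\<zeta>. cmod (\<zeta> - z) * (norm \<psi> / sqrt (1 - (cmod \<zeta>)\<^sup>2)) * norm (Y z) / cmod N) \<longlongrightarrow> 0) (at z)"
    by simp
  have "\<forall>\<^sub>F \<zeta> in at z. norm (w \<zeta> - w z) \<le> cmod (\<zeta> - z) * (norm \<psi> / sqrt (1 - (cmod \<zeta>)\<^sup>2)) * norm (Y z) / cmod N"
    using eventually_disc[OF z]
  proof eventually_elim
    case (elim \<zeta>)
    have "(norm (X \<zeta>))\<^sup>2 \<le> (norm \<psi>)\<^sup>2 / (1 - (cmod \<zeta>)\<^sup>2)"
      unfolding norm_X_divide[OF elim] using disc_square[OF elim]
      by (intro divide_right_mono mult_left_le) auto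
    then have "norm (X \<zeta>) \<le> sqrt ((norm \<psi>)\<^sup>2 / (1 - (cmod \<zeta>)\<^sup>2))"
      by (rule real_le_rsqrt)
    then have le: "norm (X \<zeta>) \<le> norm \<psi> / sqrt (1 - (cmod \<zeta>)\<^sup>2)"
      by (simp add: real_sqrt_divide)
    have "cmod (w \<zeta> - w z) * cmod N = cmod (\<zeta> - z) * cmod (cinner (X \<zeta>) (Y z))"
      using w_diff[OF X[OF elim] z] by (simp flip: norm_mult)
    also have "\<dots> \<le> cmod (\<zeta> - z) * ((norm \<psi> / sqrt (1 - (cmod \<zeta>)\<^sup>2)) * norm (Y z))"
      by (intro mult_left_mono order_trans[OF Cauchy_Schwarz] mult_right_mono le) auto
    finally show ?case
      using N_nonzero by (subst pos_le_divide_eq) (simp_all only: mult.assoc zero_less_norm_iff not_False_eq_True simp_thms)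
  qed
  then have "((\<lambda>\<zeta>. w \<zeta> - w z) \<longlongrightarrow> 0) (at z)"
    using lim by (rule Lim_null_comparison)
  then show ?thesis by (rule LIM_zero_cancel)
qed

text \<open>The kernel identity expresses the norm of \<open>X \<zeta>\<close> and its inner product
  with \<open>X z\<close> through \<open>\<zeta>\<close> and \<open>w \<zeta>\<close>, so continuity
  of \<open>w\<close> carries over.\<close>

lemma X_tendsto:
  assumes z: "cmod z < 1"
  shows "(X \<longlongrightarrow> X z) (at z)"
proof (rule tendsto_of_norm_cinner)
  have "((\<lambda>\<zeta>. (norm \<psi>)\<^sup>2 * (1 - (cmod (w \<zeta>))\<^sup>2) / (1 - (cmod \<zeta>)\<^sup>2)) \<longlongrightarrow>
      (norm \<psi>)\<^sup>2 * (1 - (cmod (w z))\<^sup>2) / (1 - (cmod z)\<^sup>2)) (at z)"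
    using disc_square[OF z] by (intro tendsto_intros w_tendsto[OF z]) auto
  then show "((\<lambda>\<zeta>. (norm (X \<zeta>))\<^sup>2) \<longlongrightarrow> (norm (X z))\<^sup>2) (at z)"
    unfolding norm_X_divide[OF z]
    by (rule Lim_transform_eventually)
      (use eventually_disc[OF z] in eventually_elim, simp add: norm_X_divide)
  have nz: "1 - \<zeta> * cnj z \<noteq> 0" if "cmod \<zeta> < 1" for \<zeta>
  proof
    assume "1 - \<zeta> * cnj z = 0"
    then have "cmod \<zeta> * cmod z = 1"
      by (metis complex_mod_cnj norm_mult norm_one right_minus_eq)
    moreover have "cmod \<zeta> * cmod z < 1"
      using mult_le_one[of "cmod \<zeta>" "cmod z"] that z mult_strict_mono'[of "cmod \<zeta>" 1 "cmod z" 1] by auto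
    ultimately show False by simp
  qed
  have eq: "cinner (X \<zeta>) (X z) = N * (1 - w \<zeta> * cnj (w z)) / (1 - \<zeta> * cnj z)" if "cmod \<zeta> < 1" for \<zeta>
    using defect_solution_kernel[OF U X[OF that] X[OF z]] nz[OF that]
    by (simp add: field_simps)
  have "((\<lambda>\<zeta>. N * (1 - w \<zeta> * cnj (w z)) / (1 - \<zeta> * cnj z)) \<longlongrightarrow> N * (1 - w z * cnj (w z)) / (1 - z * cnj z)) (at z)"
    using nz[OF z] by (intro tendsto_intros w_tendsto[OF z]) auto
  then show "((\<lambda>\<zeta>. cinner (X \<zeta>) (X z)) \<longlongrightarrow> cinner (X z) (X z)) (at z)"
    unfolding eq[OF z]
    by (rule Lim_transform_eventually)
      (use eventually_disc[OF z] in eventually_elim, simp add: eq)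
qed

text \<open>The difference quotient equals \<open>cinner (X \<zeta>) (Y z) / N\<close> exactly, so
  continuity of \<open>X\<close> suffices.\<close>

lemma w_has_derivative:
  assumes z: "cmod z < 1"
  shows "(w has_field_derivative cinner (X z) (Y z) / N) (at z)"
  unfolding has_field_derivative_iff
proof (rule Lim_transform_eventually)
  show "((\<lambda>\<zeta>. cinner (X \<zeta>) (Y z) / N) \<longlongrightarrow> cinner (X z) (Y z) / N) (at z)"
    by (intro tendsto_intros tendsto_cinner X_tendsto[OF z] N_nonzero)
  have "\<forall>\<^sub>F \<zeta> in at z. \<zeta> \<noteq> z"
    by (simp add: eventually_at_filter)
  with eventually_disc[OF z]
  show "\<forall>\<^sub>F \<zeta> in at z. cinner (X \<zeta>) (Y z) / N = (w \<zeta> - w z) / (\<zeta> - z)"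
  proof eventually_elim
    case (elim \<zeta>)
    then show ?case
      using w_diff[OF X z, of \<zeta>] N_nonzero by (simp add: field_simps)
  qed
qed

lemma deriv_w: "cmod z < 1 \<Longrightarrow> deriv w z = cinner (X z) (Y z) / N"
  by (rule DERIV_imp_deriv[OF w_has_derivative])

end

section \<open>Boundary values\<close>

lemma stolz_angleD:
  assumes "z \<in> stolz_angle \<gamma> \<alpha>"
  shows "cmod z < 1" "cmod (\<gamma> - z) < \<alpha> * (1 - cmod z)"
  using assms by (auto simp: stolz_angle_def norm_minus_commute)

section \<open>From a boundary solution to the angular derivative\<close>

context characteristic_family
begin

text \<open>On the circle the left-hand side of the norm identity vanishes.\<close>

lemma boundary_value_unimodular:
  assumes "cmod \<gamma> = 1" and "defect_solution U \<psi> \<gamma> \<kappa> x"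
  shows "cmod \<kappa> = 1"
proof -
  have "(cmod \<kappa>)\<^sup>2 = 1\<^sup>2"
    using defect_solution_norm[OF U assms(2)] assms(1) \<psi> by simp
  then show ?thesis by (rule power2_eq_imp_eq) auto
qed

text \<open>The hypothesis \<open>no_eigenvector\<close> is the form in which simplicity enters: it
  makes the boundary solution unique.\<close>

context
  fixes \<gamma> \<kappa> :: complex and x :: 'a and \<alpha> :: real
  assumes \<gamma>: "cmod \<gamma> = 1" and x: "defect_solution U \<psi> \<gamma> \<kappa> x" and \<alpha>: "\<alpha> > 1"
    and no_eigenvector: "\<And>e. cinner e \<psi> = 0 \<Longrightarrow> U e = \<gamma> *\<^sub>C e \<Longrightarrow> e = 0"
begin

private abbreviation "F \<equiv> at \<gamma> within stolz_angle \<gamma> \<alpha>"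

private lemma \<kappa>: "cmod \<kappa> = 1"
  using boundary_value_unimodular[OF \<gamma> x] .

lemma kernel_boundary: "cmod z < 1 \<Longrightarrow> (1 - z * cnj \<gamma>) * cinner (X z) x = N * (1 - w z * cnj \<kappa>)"
  using defect_solution_kernel[OF U X x] .

lemma norm_kernel_boundary:
  assumes "cmod z < 1"
  shows "cmod (\<gamma> - z) * cmod (cinner (X z) x) = (norm \<psi>)\<^sup>2 * cmod (\<kappa> - w z)"
  using arg_cong[OF kernel_boundary[OF assms], of cmod]
  by (simp add: norm_mult cinner_self norm_power cmod_one_minus_mult_cnj[OF \<gamma>] cmod_one_minus_mult_cnj[OF \<kappa>])

text \<open>The norm identity and the boundary kernel bound
  \<open>(1 - cmod z) * (norm (X z))\<^sup>2\<close> by twice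
  \<open>cmod (\<gamma> - z) * cmod (cinner (X z) x)\<close>. In the Stolz angle the first factor is
  at most \<open>\<alpha> * (1 - cmod z)\<close>, and both \<open>1 - cmod z\<close> and one power
  of the norm cancel.\<close>

lemma norm_X_stolz:
  assumes z: "z \<in> stolz_angle \<gamma> \<alpha>"
  shows "norm (X z) \<le> 2 * \<alpha> * norm x"
proof (cases "X z = 0")
  case True then show ?thesis using \<alpha> by simp
next
  case False
  note z = stolz_angleD[OF z]
  have "(1 - cmod z) * (norm (X z))\<^sup>2 \<le> (1 - (cmod z)\<^sup>2) * (norm (X z))\<^sup>2"
    using z(1) by (intro mult_right_mono) (auto simp: power2_eq_square mult_left_le)
  also have "\<dots> \<le> (norm \<psi>)\<^sup>2 * (2 * cmod (\<kappa> - w z))"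
    unfolding norm_X[OF z(1)] by (intro mult_left_mono one_minus_norm_sq_le \<kappa>) auto
  also have "\<dots> = 2 * (cmod (\<gamma> - z) * cmod (cinner (X z) x))"
    unfolding norm_kernel_boundary[OF z(1)] by simp
  also have "\<dots> \<le> 2 * ((\<alpha> * (1 - cmod z)) * (norm (X z) * norm x))"
    using z(2) by (intro mult_left_mono mult_mono Cauchy_Schwarz) (use z(1) \<alpha> in auto)
  finally have "((1 - cmod z) * norm (X z)) * norm (X z) \<le> ((1 - cmod z) * norm (X z)) * (2 * \<alpha> * norm x)"
    by (simp add: power2_eq_square algebra_simps)
  then show ?thesis
    by (rule mult_left_le_imp_le) (use False z(1) in simp)
qed

text \<open>With \<open>X z\<close> bounded, the boundary kernel identity makes
  \<open>\<kappa> - w z\<close> of the order of \<open>\<gamma> - z\<close>.\<close>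

lemma w_tendsto_boundary: "(w \<longlongrightarrow> \<kappa>) F"
proof -
  have "((\<lambda>z. cmod (\<gamma> - z) * (2 * \<alpha> * norm x * norm x) / (norm \<psi>)\<^sup>2) \<longlongrightarrow>
      cmod (\<gamma> - \<gamma>) * (2 * \<alpha> * norm x * norm x) / (norm \<psi>)\<^sup>2) F"
    using \<psi> by (intro tendsto_intros) auto
  then have lim: "((\<lambda>z. cmod (\<gamma> - z) * (2 * \<alpha> * norm x * norm x) / (norm \<psi>)\<^sup>2) \<longlongrightarrow> 0) F"
    by simp
  have "\<forall>\<^sub>F z in F. norm (w z - \<kappa>) \<le> cmod (\<gamma> - z) * (2 * \<alpha> * norm x * norm x) / (norm \<psi>)\<^sup>2"
    using eventually_in_stolz
  proof eventually_elim
    case (elim z)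
    have "cmod (\<kappa> - w z) * (norm \<psi>)\<^sup>2 = cmod (\<gamma> - z) * cmod (cinner (X z) x)"
      unfolding norm_kernel_boundary[OF stolz_angleD(1)[OF elim]] by simp
    also have "\<dots> \<le> cmod (\<gamma> - z) * (2 * \<alpha> * norm x * norm x)"
      by (intro mult_left_mono order_trans[OF Cauchy_Schwarz] mult_right_mono norm_X_stolz elim) auto
    finally show ?case
      using \<psi> by (simp add: pos_le_divide_eq norm_minus_commute)
  qed
  then have "((\<lambda>z. w z - \<kappa>) \<longlongrightarrow> 0) F"
    using lim by (rule Lim_null_comparison)
  then show ?thesis by (rule LIM_zero_cancel)
qed

lemma cinner_X_tendsto: "((\<lambda>z. cinner (X z) x) \<longlongrightarrow> cinner x x) F"
  unfolding tendsto_at_iff_sequentially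
proof (intro allI impI)
  fix s :: "nat \<Rightarrow> complex"
  assume "\<forall>i. s i \<in> stolz_angle \<gamma> \<alpha> - {\<gamma>}" and s_lim: "s \<longlonglongrightarrow> \<gamma>"
  then have s: "s i \<in> stolz_angle \<gamma> \<alpha>" "s i \<noteq> \<gamma>" for i by auto
  have w_lim: "(\<lambda>n. w (s n)) \<longlonglongrightarrow> \<kappa>"
    using w_tendsto_boundary s s_lim unfolding tendsto_at_iff_sequentially o_def by blast
  \<comment> \<open>\<open>T\<close> collects the data of the boundary equation. It is injective by
    \<open>no_eigenvector\<close>, and the \<open>X (s n)\<close> solve that equation up to an error
    tending to zero.\<close>
  define T where "T p = (U p - \<gamma> *\<^sub>C p, cinner p \<psi>)" for p
  have T_bl: "bounded_linear T"
    unfolding T_def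
    by (intro bounded_linear_Pair bounded_linear_sub unitary_bounded_linear[OF U]
        bounded_linear_scaleC_right bounded_linear_cinner_left)
  have T_diff: "T (p - q) = T p - T q" for p q
    using T_bl by (rule linear_diff[OF bounded_linear.linear])
  have T_inj: "p = x" if "T p = T x" for p
  proof -
    have "T (p - x) = 0" using that by (simp add: T_diff)
    then have "p - x = 0" by (intro no_eigenvector) (auto simp: T_def zero_prod_def)
    then show ?thesis by simp
  qed
  have bdd: "bounded (range (\<lambda>n. X (s n)))"
    unfolding bounded_iff using norm_X_stolz s(1) by blast
  have T_X: "T (X (s n)) = ((s n - \<gamma>) *\<^sub>C X (s n) + (1 - w (s n)) *\<^sub>C U \<psi>, N)" for n
    using X[OF stolz_angleD(1)[OF s(1)[of n]]]
    by (simp add: T_def defect_solution_def scaleC.scale_left_diff_distrib)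
  have "(\<lambda>n. (s n - \<gamma>) *\<^sub>C X (s n)) \<longlonglongrightarrow> 0"
  proof (rule Lim_null_comparison)
    show "\<forall>\<^sub>F n in sequentially. norm ((s n - \<gamma>) *\<^sub>C X (s n)) \<le> cmod (s n - \<gamma>) * (2 * \<alpha> * norm x)"
      unfolding norm_scaleC by (intro always_eventually allI mult_left_mono norm_X_stolz s) auto
    have "(\<lambda>n. cmod (s n - \<gamma>) * (2 * \<alpha> * norm x)) \<longlonglongrightarrow> cmod (\<gamma> - \<gamma>) * (2 * \<alpha> * norm x)"
      by (intro tendsto_intros s_lim)
    then show "(\<lambda>n. cmod (s n - \<gamma>) * (2 * \<alpha> * norm x)) \<longlonglongrightarrow> 0" by simp
  qed
  then have "(\<lambda>n. T (X (s n))) \<longlonglongrightarrow> (0 + (1 - \<kappa>) *\<^sub>C U \<psi>, N)"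
    unfolding T_X by (intro tendsto_intros tendsto_scaleC w_lim)
  moreover have "T x = (0 + (1 - \<kappa>) *\<^sub>C U \<psi>, N)"
    using x by (simp add: T_def defect_solution_def)
  ultimately have "(\<lambda>n. T (X (s n))) \<longlonglongrightarrow> T x" by simp
  from bounded_sequence_weak_limit[OF T_bl T_inj bounded_linear_cinner_left bdd this]
  show "((\<lambda>z. cinner (X z) x) \<circ> s) \<longlonglongrightarrow> cinner x x"
    by (simp add: o_def)
qed

text \<open>Weak convergence alone does not control norms. With
  \<open>u = 1 - z * cnj \<gamma>\<close> and \<open>g = cinner (X z) x\<close>, the norm identity
  becomes exact: \<open>(1 - (cmod z)\<^sup>2) * ((norm (X z))\<^sup>2 - R)\<close> is
  \<open>2 * Re (u * (g - R))\<close> plus terms quadratic in \<open>u\<close>. Since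
  \<open>cmod u\<close> is at most \<open>\<alpha> * (1 - cmod z)\<close>, dividing by
  \<open>1 - cmod z\<close> leaves the bound \<open>B z\<close>, which tends to zero.\<close>

lemma norm_X_tendsto: "((\<lambda>z. (norm (X z))\<^sup>2) \<longlongrightarrow> (norm x)\<^sup>2) F"
proof -
  define g where "g = (\<lambda>z. cinner (X z) x)"
  define R where "R = (norm x)\<^sup>2"
  define u where "u z = 1 - z * cnj \<gamma>" for z
  define B where "B z = \<alpha> * (2 * cmod (g z - of_real R) + cmod (u z) * ((cmod (g z))\<^sup>2 / (norm \<psi>)\<^sup>2 + R))" for z
  have g_lim: "(g \<longlongrightarrow> of_real R) F"
    using cinner_X_tendsto by (simp add: g_def R_def cinner_self)
  have "(u \<longlongrightarrow> 1 - \<gamma> * cnj \<gamma>) F"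
    unfolding u_def by (intro tendsto_intros)
  then have u_lim: "(u \<longlongrightarrow> 0) F"
    by (simp add: cmod_unit_mult_cnj[OF \<gamma>])
  have "(B \<longlongrightarrow> \<alpha> * (2 * cmod (of_real R - of_real R) + cmod 0 * ((cmod (of_real R))\<^sup>2 / (norm \<psi>)\<^sup>2 + R))) F"
    unfolding B_def using \<psi> by (intro tendsto_intros g_lim u_lim) auto
  then have B_lim: "(B \<longlongrightarrow> 0) F" by simp
  have "\<forall>\<^sub>F z in F. norm ((norm (X z))\<^sup>2 - R) \<le> B z"
    using eventually_in_stolz
  proof eventually_elim
    case (elim z)
    note z = stolz_angleD[OF elim]
    \<comment> \<open>By the kernel identity this is \<open>1 - w z * cnj \<kappa>\<close>, the
      counterpart of \<open>u z\<close> for the values of \<open>w\<close>.\<close>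
    define t where "t = u z * g z / N"
    have Nr: "N = of_real ((norm \<psi>)\<^sup>2)" by (rule cinner_self)
    have "w z * cnj \<kappa> = 1 - t"
      using kernel_boundary[OF z(1)] N_nonzero by (simp add: t_def u_def g_def field_simps)
    then have "cmod (w z) = cmod (1 - t)"
      using \<kappa> by (metis complex_mod_cnj mult.right_neutral norm_mult)
    then have a: "1 - (cmod (w z))\<^sup>2 = 2 * Re t - (cmod t)\<^sup>2"
      by (simp add: cmod_power2 power2_diff)
    have b: "Re (u z * g z) = (norm \<psi>)\<^sup>2 * Re t"
      using \<psi> by (simp add: t_def Nr)
    have c: "cmod (u z * g z) = (norm \<psi>)\<^sup>2 * cmod t"
      using \<psi> by (simp add: t_def Nr norm_divide norm_mult norm_power)
    have 1: "(1 - (cmod z)\<^sup>2) * (norm (X z))\<^sup>2 = 2 * Re (u z * g z) - (cmod (u z * g z))\<^sup>2 / (norm \<psi>)\<^sup>2"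
      unfolding norm_X[OF z(1)] a b c using \<psi> by (simp add: power2_eq_square field_simps)
    have "cmod z = cmod (1 - u z)"
      using \<gamma> by (simp add: u_def norm_mult)
    then have 2: "1 - (cmod z)\<^sup>2 = 2 * Re (u z) - (cmod (u z))\<^sup>2"
      by (simp add: cmod_power2 power2_diff)
    have 3: "Re (u z * (g z - of_real R)) = Re (u z * g z) - R * Re (u z)"
      by (simp add: algebra_simps)
    have "(1 - (cmod z)\<^sup>2) * ((norm (X z))\<^sup>2 - R) =
        2 * Re (u z * (g z - of_real R)) - (cmod (u z * g z))\<^sup>2 / (norm \<psi>)\<^sup>2 + R * (cmod (u z))\<^sup>2"
      unfolding right_diff_distrib 1 3 unfolding 2 by (simp add: algebra_simps)
    also have "\<bar>\<dots>\<bar> \<le> 2 * cmod (u z * (g z - of_real R)) + (cmod (u z * g z))\<^sup>2 / (norm \<psi>)\<^sup>2 + R * (cmod (u z))\<^sup>2"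
    proof -
      have tri: "\<bar>2 * a - b + c\<bar> \<le> 2 * d + b + c" if "\<bar>a\<bar> \<le> d" "0 \<le> b" "0 \<le> c" for a b c d :: real
        using that by linarith
      show ?thesis by (intro tri abs_Re_le_cmod) (simp_all add: R_def)
    qed
    also have "\<dots> = cmod (u z) * (B z / \<alpha>)"
    proof -
      have "B z / \<alpha> = 2 * cmod (g z - of_real R) + cmod (u z) * ((cmod (g z))\<^sup>2 / (norm \<psi>)\<^sup>2 + R)"
        using \<alpha> by (simp add: B_def)
      then show ?thesis
        unfolding norm_mult power_mult_distrib by (simp add: distrib_left power2_eq_square mult_ac)
    qed
    also have "\<dots> \<le> (\<alpha> * (1 - cmod z)) * (B z / \<alpha>)"
    proof (rule mult_right_mono)
      show "cmod (u z) \<le> \<alpha> * (1 - cmod z)"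
        using z(2) by (simp add: u_def cmod_one_minus_mult_cnj[OF \<gamma>])
      show "0 \<le> B z / \<alpha>" using \<alpha> by (simp add: B_def R_def)
    qed
    also have "\<dots> = (1 - cmod z) * B z" using \<alpha> by simp
    finally have "(1 - (cmod z)\<^sup>2) * \<bar>(norm (X z))\<^sup>2 - R\<bar> \<le> (1 - cmod z) * B z"
      using disc_square[OF z(1)] by (simp add: abs_mult)
    moreover have "(1 - cmod z) * \<bar>(norm (X z))\<^sup>2 - R\<bar> \<le> (1 - (cmod z)\<^sup>2) * \<bar>(norm (X z))\<^sup>2 - R\<bar>"
      using z(1) by (intro mult_right_mono) (auto simp: power2_eq_square mult_left_le)
    ultimately have "(1 - cmod z) * \<bar>(norm (X z))\<^sup>2 - R\<bar> \<le> (1 - cmod z) * B z"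
      by linarith
    then show ?case
      using z(1) by (simp add: mult_le_cancel_left_pos)
  qed
  then have "((\<lambda>z. (norm (X z))\<^sup>2 - R) \<longlongrightarrow> 0) F"
    using B_lim by (rule Lim_null_comparison)
  then show ?thesis unfolding R_def by (rule LIM_zero_cancel)
qed

lemma X_tendsto_boundary: "(X \<longlongrightarrow> x) F"
  using norm_X_tendsto cinner_X_tendsto by (rule tendsto_of_norm_cinner)

text \<open>Split \<open>X z\<close> in the formula for the derivative into \<open>X z - x\<close>
  and \<open>x\<close>. The first part vanishes in the limit because \<open>Y z\<close> is as
  bounded as \<open>X z\<close>; for the second, the pairing and kernel identities turn
  \<open>cinner x (Y z)\<close> into a multiple of \<open>cinner (X z) x\<close>, whose limit is
  known.\<close>

lemma deriv_w_tendsto_boundary: "(deriv w \<longlongrightarrow> \<kappa> * cnj \<gamma> * cinner x x / N) F"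
proof -
  have "((\<lambda>z. cinner (X z - x) (Y z)) \<longlongrightarrow> 0) F"
  proof (rule Lim_null_comparison)
    show "\<forall>\<^sub>F z in F. norm (cinner (X z - x) (Y z)) \<le> norm (X z - x) * (2 * \<alpha> * norm x)"
      using eventually_in_stolz
    proof eventually_elim
      case (elim z)
      then show ?case
        using norm_X_stolz[OF elim] norm_Y[of z] stolz_angleD(1)[OF elim]
        by (intro order_trans[OF Cauchy_Schwarz] mult_left_mono) auto
    qed
    have "((\<lambda>z. norm (X z - x) * (2 * \<alpha> * norm x)) \<longlongrightarrow> norm (x - x) * (2 * \<alpha> * norm x)) F"
      by (intro tendsto_intros X_tendsto_boundary)
    then show "((\<lambda>z. norm (X z - x) * (2 * \<alpha> * norm x)) \<longlongrightarrow> 0) F" by simp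
  qed
  then have "((\<lambda>z. (cinner (X z - x) (Y z) + \<kappa> * cnj \<gamma> * cinner (X z) x) / N) \<longlongrightarrow>
      (0 + \<kappa> * cnj \<gamma> * cinner x x) / N) F"
    by (intro tendsto_intros cinner_X_tendsto N_nonzero)
  then have lim: "((\<lambda>z. (cinner (X z - x) (Y z) + \<kappa> * cnj \<gamma> * cinner (X z) x) / N) \<longlongrightarrow>
      \<kappa> * cnj \<gamma> * cinner x x / N) F" by simp
  show ?thesis
  proof (rule Lim_transform_eventually[OF lim])
    show "\<forall>\<^sub>F z in F. (cinner (X z - x) (Y z) + \<kappa> * cnj \<gamma> * cinner (X z) x) / N = deriv w z"
      using eventually_in_stolz
    proof eventually_elim
      case (elim z)
      note z = stolz_angleD(1)[OF elim]
      have "\<gamma> - z \<noteq> 0" using z \<gamma> by auto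
      moreover have "(\<gamma> - z) * cinner x (Y z) = (\<gamma> - z) * (\<kappa> * cnj \<gamma> * cinner (X z) x)"
      proof -
        have "(\<gamma> - z) * (\<kappa> * cnj \<gamma> * cinner (X z) x) = \<kappa> * ((\<gamma> * cnj \<gamma> - z * cnj \<gamma>) * cinner (X z) x)"
          by (simp add: algebra_simps)
        also have "\<dots> = \<kappa> * (N * (1 - w z * cnj \<kappa>))"
          by (simp add: cmod_unit_mult_cnj[OF \<gamma>] kernel_boundary[OF z])
        also have "\<dots> = N * (\<kappa> - w z * (\<kappa> * cnj \<kappa>))"
          by (simp add: algebra_simps)
        also have "\<dots> = (\<gamma> - z) * cinner x (Y z)"
          by (simp add: cmod_unit_mult_cnj[OF \<kappa>] w_diff[OF x z])
        finally show ?thesis by (rule sym)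
      qed
      ultimately have "cinner x (Y z) = \<kappa> * cnj \<gamma> * cinner (X z) x"
        by (rule mult_left_cancel[THEN iffD1])
      then show ?case
        by (simp add: deriv_w[OF z] cinner_diff_left)
    qed
  qed
qed

end

lemma has_angular_derivative_if_defect_solution:
  assumes \<gamma>: "cmod \<gamma> = 1" and x: "defect_solution U \<psi> \<gamma> \<kappa> x"
    and no_eigenvector: "\<And>e. cinner e \<psi> = 0 \<Longrightarrow> U e = \<gamma> *\<^sub>C e \<Longrightarrow> e = 0"
  shows "has_angular_derivative w \<gamma>"
  unfolding has_angular_derivative_def nt_limit_def
proof (intro conjI exI allI impI)
  fix \<alpha> :: real assume \<alpha>: "\<alpha> > 1"
  show "(w \<longlongrightarrow> \<kappa>) (at \<gamma> within stolz_angle \<gamma> \<alpha>)"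
    using w_tendsto_boundary[OF \<gamma> x \<alpha> no_eigenvector] .
  show "(deriv w \<longlongrightarrow> \<kappa> * cnj \<gamma> * cinner x x / N) (at \<gamma> within stolz_angle \<gamma> \<alpha>)"
    using deriv_w_tendsto_boundary[OF \<gamma> x \<alpha> no_eigenvector] .
qed (rule boundary_value_unimodular[OF \<gamma> x])

section \<open>From the angular derivative to a boundary solution\<close>

text \<open>Boundedness of the derivative along the radius makes \<open>L - w\<close> at most a
  constant times the distance to \<open>\<gamma>\<close>. The norm identity then bounds
  \<open>X\<close> there, and a weak point of these vectors solves the boundary equation with
  \<open>\<kappa> = L\<close>.\<close>

lemma defect_solution_if_has_angular_derivative:
  assumes \<gamma>: "cmod \<gamma> = 1" and "has_angular_derivative w \<gamma>"
  shows "\<exists>\<kappa> x. defect_solution U \<psi> \<gamma> \<kappa> x"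
proof -
  \<comment> \<open>Aperture 2 contains the radius: at distance \<open>t\<close> from
    \<open>\<gamma>\<close> the condition reads \<open>t < 2 * t\<close>.\<close>
  let ?S = "stolz_angle \<gamma> 2"
  have nt: "(f \<longlongrightarrow> l) (at \<gamma> within ?S)" if "nt_limit f \<gamma> l" for f l
    using that[unfolded nt_limit_def, rule_format, of 2] by simp
  obtain L L' where L: "cmod L = 1" "nt_limit w \<gamma> L" "nt_limit (deriv w) \<gamma> L'"
    using assms(2) unfolding has_angular_derivative_def by blast
  define C where "C = cmod L' + 1"
  have "\<forall>\<^sub>F z in at \<gamma> within ?S. cmod (deriv w z) < C"
    by (intro order_tendstoD(2)[OF tendsto_norm[OF nt[OF L(3)]]]) (simp add: C_def)
  then obtain d where d: "d > 0" "\<And>z. z \<in> ?S \<Longrightarrow> z \<noteq> \<gamma> \<Longrightarrow> dist z \<gamma> < d \<Longrightarrow> cmod (deriv w z) < C"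
    unfolding eventually_at by blast
  define \<rho> where "\<rho> = (\<lambda>t. of_real (1 - t) * \<gamma>)"
  have \<rho>_norm: "cmod (\<rho> t) = 1 - t" if "0 < t" "t < 1" for t
    unfolding \<rho>_def norm_mult norm_of_real using that \<gamma> by simp
  have \<rho>_dist: "cmod (\<rho> s - \<rho> t) = \<bar>t - s\<bar>" for s t
  proof -
    have "\<rho> s - \<rho> t = of_real (t - s) * \<gamma>" by (simp add: \<rho>_def algebra_simps)
    then show ?thesis using \<gamma> by (simp only: norm_mult norm_of_real mult_1_right)
  qed
  have \<rho>_0: "\<rho> 0 = \<gamma>" by (simp add: \<rho>_def)
  have \<rho>_stolz: "\<rho> t \<in> ?S" if "0 < t" "t < 1" for t
    using that \<rho>_norm[OF that] \<rho>_dist[of t 0] by (simp add: stolz_angle_def \<rho>_0)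
  have \<rho>_ne: "\<rho> t \<noteq> \<gamma>" if "0 < t" "t < 1" for t
    using \<rho>_norm[OF that] that \<gamma> by auto
  \<comment> \<open>The cap at 1 keeps \<open>\<rho> t\<close> in the disc, on the radius that ends
    at \<open>\<gamma>\<close>.\<close>
  define e where "e = min d 1"
  have e: "e > 0" "e \<le> d" "e \<le> 1" using d by (auto simp: e_def)
  have lip: "cmod (w (\<rho> s) - w (\<rho> t)) \<le> C * \<bar>t - s\<bar>" if s: "0 < s" "s < e" and t: "0 < t" "t < e" for s t
  proof -
    have "cmod (w (\<rho> s) - w (\<rho> t)) \<le> C * cmod (\<rho> s - \<rho> t)"
    \<comment> \<open>Mean value inequality on the radial segment, which is convex.\<close>
    proof (rule field_differentiable_bound[of "\<rho> ` {0<..<e}" w "deriv w"])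
      have "linear (\<lambda>t. complex_of_real t * \<gamma>)"
        by (intro linearI) (simp_all add: algebra_simps scaleR_conv_of_real)
      then have "convex ((\<lambda>t. complex_of_real t * \<gamma>) ` {1-e<..<1})"
        by (intro convex_linear_image) auto
      moreover have "\<rho> ` {0<..<e} = (\<lambda>t. complex_of_real t * \<gamma>) ` {1-e<..<1}"
      proof -
        have "u \<in> (\<lambda>t. 1 - t) ` {0<..<e}" if "u \<in> {1-e<..<1}" for u
          using that by (intro image_eqI[of _ _ "1 - u"]) auto
        then have "{1-e<..<1} = (\<lambda>t. 1 - t) ` {0<..<e}" by auto
        then show ?thesis by (simp only: image_image \<rho>_def)
      qed
      ultimately show "convex (\<rho> ` {0<..<e})" by simp
    next
      fix z assume "z \<in> \<rho> ` {0<..<e}"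
      then obtain r where r: "z = \<rho> r" "0 < r" "r < e" by auto
      then have r1: "r < 1" and rd: "dist z \<gamma> < d"
        using e \<rho>_dist[of r 0] by (auto simp: dist_norm \<rho>_0)
      show "cmod (deriv w z) \<le> C"
        using d(2)[of z] \<rho>_stolz[OF r(2) r1] \<rho>_ne[OF r(2) r1] rd r(1) by simp
      have "cmod z < 1" using stolz_angleD(1)[OF \<rho>_stolz[OF r(2) r1]] r(1) by simp
      then show "(w has_field_derivative deriv w z) (at z within \<rho> ` {0<..<e})"
        using w_has_derivative deriv_w has_field_derivative_at_within by metis
    qed (use s t in auto)
    then show ?thesis by (simp add: \<rho>_dist)
  qed
  have \<rho>_filter: "filterlim \<rho> (at \<gamma> within ?S) (at_right 0)"
    unfolding filterlim_at
  proof
    have "(\<rho> \<longlongrightarrow> of_real (1 - 0) * \<gamma>) (at_right 0)"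
      unfolding \<rho>_def by (intro tendsto_intros)
    then show "(\<rho> \<longlongrightarrow> \<gamma>) (at_right 0)" by simp
    show "\<forall>\<^sub>F t in at_right 0. \<rho> t \<in> ?S \<and> \<rho> t \<noteq> \<gamma>"
      unfolding eventually_at_right_field using \<rho>_stolz \<rho>_ne by (intro exI[of _ 1]) auto
  qed
  have w_lim: "((\<lambda>t. w (\<rho> t)) \<longlongrightarrow> L) (at_right 0)"
    by (rule filterlim_compose[OF nt[OF L(2)] \<rho>_filter])
  \<comment> \<open>Let \<open>s\<close> tend to 0 in \<open>lip\<close>, so that one endpoint moves
    to \<open>\<gamma>\<close>.\<close>
  have lip0: "cmod (L - w (\<rho> t)) \<le> C * t" if t: "0 < t" "t < e" for t
  proof (rule tendsto_le)
    show "((\<lambda>s. cmod (w (\<rho> s) - w (\<rho> t))) \<longlongrightarrow> cmod (L - w (\<rho> t))) (at_right 0)"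
      by (intro tendsto_intros w_lim)
    have "((\<lambda>s. C * \<bar>t - s\<bar>) \<longlongrightarrow> C * \<bar>t - 0\<bar>) (at_right 0)"
      by (intro tendsto_intros)
    then show "((\<lambda>s. C * \<bar>t - s\<bar>) \<longlongrightarrow> C * t) (at_right 0)"
      using t by simp
    show "\<forall>\<^sub>F s in at_right 0. cmod (w (\<rho> s) - w (\<rho> t)) \<le> C * \<bar>t - s\<bar>"
      unfolding eventually_at_right_field using lip t e by (intro exI[of _ e]) auto
  qed simp
  \<comment> \<open>The double successor makes the factor less than 1 already for
    \<open>n = 0\<close>, so that \<open>\<tau> n < e\<close>.\<close>
  define \<tau> where "\<tau> n = e * inverse (real (Suc (Suc n)))" for n
  have \<tau>: "0 < \<tau> n" "\<tau> n < e" for n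
  proof -
    show "0 < \<tau> n" using e by (simp add: \<tau>_def)
    have "inverse (real (Suc (Suc n))) < 1" by (simp add: field_simps)
    then show "\<tau> n < e" unfolding \<tau>_def using e by simp
  qed
  have \<tau>1: "\<tau> n < 1" for n using \<tau>[of n] e by linarith
  have "\<tau> \<longlonglongrightarrow> e * 0"
    unfolding \<tau>_def by (intro tendsto_mult tendsto_const LIMSEQ_Suc[OF LIMSEQ_inverse_real_of_nat])
  then have \<tau>_lim: "\<tau> \<longlonglongrightarrow> 0" by simp
  have "filterlim \<tau> (at_right 0) sequentially"
    unfolding filterlim_at using \<tau>_lim \<tau>(1) by (auto intro!: always_eventually simp: less_imp_neq[THEN not_sym])
  then have w\<tau>_lim: "(\<lambda>n. w (\<rho> (\<tau> n))) \<longlonglongrightarrow> L"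
    by (rule filterlim_compose[OF w_lim])
  let ?s = "\<lambda>n. X (\<rho> (\<tau> n))"
  have \<rho>\<tau>: "cmod (\<rho> (\<tau> n)) < 1" for n
    using stolz_angleD(1)[OF \<rho>_stolz[OF \<tau>(1) \<tau>1]] .
  \<comment> \<open>At distance \<open>t\<close> from \<open>\<gamma>\<close>,
    \<open>1 - (1 - t)\<^sup>2\<close> is at least \<open>t\<close>, while
    \<open>1 - (cmod w)\<^sup>2\<close> is at most \<open>2 * C * t\<close>; the factor
    \<open>t\<close> cancels.\<close>
  have s_bound: "norm (?s n) \<le> sqrt ((norm \<psi>)\<^sup>2 * (2 * C))" for n
  proof (rule real_le_rsqrt)
    let ?t = "\<tau> n"
    have "?t * (norm (?s n))\<^sup>2 \<le> (1 - (cmod (\<rho> ?t))\<^sup>2) * (norm (?s n))\<^sup>2"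
    proof (rule mult_right_mono)
      have "(1 - ?t)\<^sup>2 \<le> 1 - ?t"
        using \<tau>(1)[of n] \<tau>1[of n] by (simp add: power2_eq_square mult_left_le)
      then show "?t \<le> 1 - (cmod (\<rho> ?t))\<^sup>2"
        by (simp add: \<rho>_norm[OF \<tau>(1) \<tau>1])
    qed simp
    also have "\<dots> \<le> (norm \<psi>)\<^sup>2 * (2 * cmod (L - w (\<rho> ?t)))"
      unfolding norm_X[OF \<rho>\<tau>] by (intro mult_left_mono one_minus_norm_sq_le L) auto
    also have "\<dots> \<le> (norm \<psi>)\<^sup>2 * (2 * (C * ?t))"
      by (intro mult_left_mono lip0 \<tau>) auto
    finally have "?t * (norm (?s n))\<^sup>2 \<le> ?t * ((norm \<psi>)\<^sup>2 * (2 * C))"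
      by (simp add: mult_ac)
    then show "(norm (?s n))\<^sup>2 \<le> (norm \<psi>)\<^sup>2 * (2 * C)"
      using \<tau>(1)[of n] by (simp add: mult_le_cancel_left_pos)
  qed
  then have bdd: "bounded (range ?s)"
    unfolding bounded_iff by blast
  define T where "T p = (U p - \<gamma> *\<^sub>C p, cinner p \<psi>)" for p
  have T_bl: "bounded_linear T"
    unfolding T_def
    by (intro bounded_linear_Pair bounded_linear_sub unitary_bounded_linear[OF U]
        bounded_linear_scaleC_right bounded_linear_cinner_left)
  have T_X: "T (?s n) = ((\<rho> (\<tau> n) - \<gamma>) *\<^sub>C ?s n + (1 - w (\<rho> (\<tau> n))) *\<^sub>C U \<psi>, N)" for n
    using X[OF \<rho>\<tau>[of n]]
    by (simp add: T_def defect_solution_def scaleC.scale_left_diff_distrib)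
  have "(\<lambda>n. (\<rho> (\<tau> n) - \<gamma>) *\<^sub>C ?s n) \<longlonglongrightarrow> 0"
  proof (rule Lim_null_comparison)
    have "cmod (\<rho> (\<tau> n) - \<gamma>) = \<tau> n" for n
      using \<rho>_dist[of "\<tau> n" 0] \<tau>(1)[of n] by (simp add: \<rho>_0)
    then show "\<forall>\<^sub>F n in sequentially. norm ((\<rho> (\<tau> n) - \<gamma>) *\<^sub>C ?s n) \<le> \<tau> n * sqrt ((norm \<psi>)\<^sup>2 * (2 * C))"
      using s_bound \<tau>(1) by (intro always_eventually allI) (simp add: norm_scaleC mult_left_mono less_imp_le)
    have "(\<lambda>n. \<tau> n * sqrt ((norm \<psi>)\<^sup>2 * (2 * C))) \<longlonglongrightarrow> 0 * sqrt ((norm \<psi>)\<^sup>2 * (2 * C))"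
      by (intro tendsto_intros \<tau>_lim)
    then show "(\<lambda>n. \<tau> n * sqrt ((norm \<psi>)\<^sup>2 * (2 * C))) \<longlonglongrightarrow> 0" by simp
  qed
  then have "(\<lambda>n. T (?s n)) \<longlonglongrightarrow> (0 + (1 - L) *\<^sub>C U \<psi>, N)"
    unfolding T_X by (intro tendsto_intros tendsto_scaleC w\<tau>_lim)
  then obtain x where "T x = (0 + (1 - L) *\<^sub>C U \<psi>, N)"
    using bounded_sequence_weak_point[OF T_bl bdd] by blast
  then have "defect_solution U \<psi> \<gamma> L x"
    by (simp add: T_def defect_solution_def algebra_simps)
  then show ?thesis by blast
qed

end

section \<open>Unitary extensions and the inverse Cayley transform\<close>

text \<open>Both families come from \<open>defect_solution_char_fun\<close>, applied to
  \<open>U\<close> and to its inverse. That their values are conjugate is the pairing identity at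
  equal points, where the left-hand side vanishes.\<close>

lemma characteristic_family_char_fun:
  fixes U :: "'a::chilbert_space \<Rightarrow> 'a"
  assumes U: "unitary U" and \<psi>: "\<psi> \<noteq> 0"
  obtains X Y where "characteristic_family U \<psi> (char_fun U \<psi>) X Y"
proof -
  have "\<exists>x. cmod z < 1 \<longrightarrow> defect_solution U \<psi> z (char_fun U \<psi> z) x" for z
    using defect_solution_char_fun[OF U _ \<psi>] by blast
  then obtain X where X: "\<And>z. cmod z < 1 \<Longrightarrow> defect_solution U \<psi> z (char_fun U \<psi> z) (X z)"
    by metis
  have "U \<psi> \<noteq> 0"
    using unitary_norm[OF U, of \<psi>] \<psi> by auto
  have "\<exists>y. cmod z < 1 \<longrightarrow> defect_solution (inv U) (U \<psi>) (cnj z) (cnj (char_fun U \<psi> z)) y" for z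
  proof (cases "cmod z < 1")
    case z: True
    define w' where "w' = char_fun (inv U) (U \<psi>) (cnj z)"
    obtain y where y: "defect_solution (inv U) (U \<psi>) (cnj z) w' y"
      using defect_solution_char_fun[OF unitary_inv[OF U] _ \<open>U \<psi> \<noteq> 0\<close>, of "cnj z"] z
      by (auto simp: w'_def)
    have "(char_fun U \<psi> z - cnj w') * cinner \<psi> \<psi> = 0"
      using defect_solution_pairing[OF U X[OF z] y] by simp
    then have "cnj (char_fun U \<psi> z) = w'"
      using \<psi> by (simp add: cinner_eq_zero_iff)
    then show ?thesis using y by blast
  qed simp
  then obtain Y where "\<And>z. cmod z < 1 \<Longrightarrow>
      defect_solution (inv U) (U \<psi>) (cnj z) (cnj (char_fun U \<psi> z)) (Y z)"
    by metis
  with U \<psi> X have "characteristic_family U \<psi> (char_fun U \<psi>) X Y"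
    by (intro characteristic_family.intro)
  then show thesis by (rule that)
qed

section \<open>One-dimensional defect spaces and the exclusion of eigenvectors in the domain\<close>

lemma one_dimensional_eq_range:
  assumes "one_dimensional S" and "\<psi> \<in> S" and "\<psi> \<noteq> 0"
  shows "S = range (\<lambda>c. c *\<^sub>C \<psi>)"
proof -
  obtain \<phi> where \<phi>: "S = range (\<lambda>c. c *\<^sub>C \<phi>)"
    using assms(1) by (auto simp: one_dimensional_def)
  then obtain a where a: "\<psi> = a *\<^sub>C \<phi>" using assms(2) by auto
  then have "a \<noteq> 0" using assms(3) by auto
  then have "c *\<^sub>C \<phi> = (c / a) *\<^sub>C \<psi>" for c
    by (simp add: a scaleC_scaleC)
  then have "S \<subseteq> range (\<lambda>c. c *\<^sub>C \<psi>)"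
    unfolding \<phi> by blast
  moreover have "c *\<^sub>C \<psi> = (c * a) *\<^sub>C \<phi>" for c
    by (simp add: a scaleC_scaleC)
  then have "range (\<lambda>c. c *\<^sub>C \<psi>) \<subseteq> S"
    unfolding \<phi> by blast
  ultimately show ?thesis by blast
qed

text \<open>Project \<open>y\<close> onto \<open>D\<close>: the remainder is a multiple of
  \<open>\<psi>\<close> and, if \<open>y\<close> is orthogonal to \<open>\<psi>\<close>, also
  orthogonal to \<open>\<psi>\<close>, hence zero.\<close>

lemma closed_csubspace_orth_range:
  fixes D :: "'a::chilbert_space set"
  assumes D: "closed_csubspace D" and orth: "orth D = range (\<lambda>c. c *\<^sub>C \<psi>)"
  shows "D = {y. cinner y \<psi> = 0}"
proof -
  have "\<psi> \<in> orth D"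
    unfolding orth by (rule range_eqI[of _ _ 1]) (simp add: scaleC_one)
  then have D_orth: "cinner y \<psi> = 0" if "y \<in> D" for y
    using that by (auto simp: orth_def)
  moreover have "y \<in> D" if y: "cinner y \<psi> = 0" for y
  proof -
    have "csubspace D" "closure D = D"
      using D by (auto simp: closed_csubspace_def)
    then obtain q where q: "q \<in> D" "y - q \<in> orth D"
      using csubspace_projection[of D y] by auto
    then obtain c where c: "y - q = c *\<^sub>C \<psi>" using orth by auto
    have "cinner (y - q) (y - q) = cnj c * cinner (y - q) \<psi>"
      by (subst (2) c) (rule cinner_scaleC_right)
    also have "\<dots> = 0" using y D_orth[OF q(1)] by (simp add: cinner_diff_left)
    finally show "y \<in> D" using q(1) by (simp add: cinner_eq_zero_iff)
  qed
  ultimately show ?thesis by auto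
qed

text \<open>For \<open>x\<close> nonzero the line is the solution set of the continuous equation
  \<open>cinner x x *\<^sub>C y = cinner y x *\<^sub>C x\<close>.\<close>

lemma closed_line: "closed (range (\<lambda>c. c *\<^sub>C (x::'a::complex_inner)))"
proof (cases "x = 0")
  case True
  then show ?thesis by (simp add: image_constant_conv)
next
  case False
  have "range (\<lambda>c. c *\<^sub>C x) = {y. cinner x x *\<^sub>C y = cinner y x *\<^sub>C x}"
  proof (intro set_eqI iffI)
    fix y assume "y \<in> {y. cinner x x *\<^sub>C y = cinner y x *\<^sub>C x}"
    then have "inverse (cinner x x) *\<^sub>C (cinner x x *\<^sub>C y) = inverse (cinner x x) *\<^sub>C (cinner y x *\<^sub>C x)"
      by simp
    then have "y = (inverse (cinner x x) * cinner y x) *\<^sub>C x"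
      using False by (simp add: scaleC_scaleC scaleC_one cinner_eq_zero_iff)
    then show "y \<in> range (\<lambda>c. c *\<^sub>C x)" by blast
  qed (auto simp: cinner_scaleC_left scaleC_scaleC mult.commute)
  also have "closed \<dots>"
    by (intro closed_Collect_eq linear_continuous_on bounded_linear_scaleC_right
        bounded_linear_compose[OF bounded_bilinear.bounded_linear_left[OF bounded_bilinear_scaleC] bounded_linear_cinner_left])
  finally show ?thesis .
qed

text \<open>An eigenvector in \<open>D\<close> with nonzero eigenvalue spans a closed line that
  \<open>V\<close> maps onto itself, which simplicity forbids.\<close>

lemma simple_isometric_no_eigenvector:
  assumes simple: "simple_isometric D V" and V: "isometric_lt D V"
    and x: "x \<in> D" and eig: "V x = \<gamma> *\<^sub>C x" and \<gamma>: "cmod \<gamma> = 1"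
  shows "x = 0"
proof (rule ccontr)
  assume "x \<noteq> 0"
  let ?M = "range (\<lambda>c. c *\<^sub>C x)"
  have "csubspace D" and hom: "\<And>c. V (c *\<^sub>C x) = c *\<^sub>C V x"
    using V x by (auto simp: isometric_lt_def closed_csubspace_def)
  then have "?M \<subseteq> D" using x by (auto simp: csubspace_def)
  moreover have "closed_csubspace ?M"
    unfolding closed_csubspace_def csubspace_def
  proof (intro conjI closed_line ballI allI)
    show "0 \<in> ?M" by (rule range_eqI[of _ _ 0]) simp
  next
    fix y z assume "y \<in> ?M" "z \<in> ?M"
    then obtain a b where "y = a *\<^sub>C x" "z = b *\<^sub>C x" by blast
    then show "y + z \<in> ?M" by (intro range_eqI[of _ _ "a + b"]) (simp add: scaleC_add_left)
  next
    fix c y assume "y \<in> ?M"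
    then obtain a where "y = a *\<^sub>C x" by blast
    then show "c *\<^sub>C y \<in> ?M" by (intro range_eqI[of _ _ "c * a"]) (simp add: scaleC_scaleC)
  qed
  moreover have "?M \<noteq> {0}"
  proof
    assume "?M = {0}"
    moreover have "1 *\<^sub>C x \<in> ?M" by blast
    ultimately have "1 *\<^sub>C x = 0" by blast
    then show False using \<open>x \<noteq> 0\<close> by (simp add: scaleC_one)
  qed
  moreover have "V ` ?M = ?M"
  proof (intro equalityI subsetI)
    fix y assume "y \<in> V ` ?M"
    then obtain c where "y = V (c *\<^sub>C x)" by blast
    then show "y \<in> ?M" by (intro range_eqI[of _ _ "c * \<gamma>"]) (simp add: hom eig scaleC_scaleC)
  next
    fix y assume "y \<in> ?M"
    then obtain c where "y = c *\<^sub>C x" by blast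
    then have "y = V ((c / \<gamma>) *\<^sub>C x)"
      using \<gamma> by (auto simp: hom eig scaleC_scaleC)
    then show "y \<in> V ` ?M" by blast
  qed
  ultimately show False
    using simple unfolding simple_isometric_def by blast
qed

text \<open>Rescaling enforces the normalisation against \<open>\<psi>\<close>, and
  \<open>\<kappa>\<close> absorbs the resulting coefficient of \<open>U \<psi>\<close>.\<close>

lemma defect_solution_scale:
  assumes U: "unitary U" and x: "U x = \<gamma> *\<^sub>C x + c *\<^sub>C U \<psi>" and ne: "cinner x \<psi> \<noteq> 0"
  shows "\<exists>\<kappa> y. defect_solution U \<psi> \<gamma> \<kappa> y"
proof (intro exI)
  let ?s = "cinner \<psi> \<psi> / cinner x \<psi>"
  show "defect_solution U \<psi> \<gamma> (1 - ?s * c) (?s *\<^sub>C x)"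
    using ne by (simp add: defect_solution_def cinner_scaleC_left unitary_scaleC[OF U] x
        scaleC_add_right scaleC_scaleC mult.commute)
qed

section \<open>Eigenvalues of the unitary extensions and density of the range of
  \<open>1 - V\<close>\<close>

locale simple_isometry_extension =
  fixes D :: "'a::chilbert_space set" and V U :: "'a \<Rightarrow> 'a" and \<psi> :: 'a
  assumes V: "isometric_lt D V" and simple: "simple_isometric D V"
    and ext: "unitary_extension U D V"
    and orth_D: "orth D = range (\<lambda>c. c *\<^sub>C \<psi>)" and \<psi>: "\<psi> \<noteq> 0"
begin

lemma U: "unitary U"
  using ext by (simp add: unitary_extension_def)

lemma in_D_iff: "y \<in> D \<longleftrightarrow> cinner y \<psi> = 0"
  using closed_csubspace_orth_range[OF _ orth_D] V by (auto simp: isometric_lt_def)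

lemma V_eq_U: "cinner d \<psi> = 0 \<Longrightarrow> V d = U d"
  using ext by (simp add: unitary_extension_def in_D_iff)

lemma orth_D_ex: "(\<And>d. cinner d \<psi> = 0 \<Longrightarrow> cinner d u = 0) \<Longrightarrow> \<exists>c. u = c *\<^sub>C \<psi>"
  using orth_D by (auto simp: orth_def in_D_iff)

lemma no_eigenvector:
  assumes "cinner e \<psi> = 0" and "U e = \<gamma> *\<^sub>C e" and "cmod \<gamma> = 1"
  shows "e = 0"
  using simple_isometric_no_eigenvector[OF simple V, of e \<gamma>] assms by (simp add: in_D_iff V_eq_U)

text \<open>Two unitary extensions agree on the orthogonal complement of \<open>\<psi>\<close>, so
  they differ only by a factor \<open>\<kappa>\<close> on \<open>\<psi>\<close>. The eigenvector has
  a nonzero component along \<open>\<psi>\<close>, for otherwise it would be an eigenvector in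
  \<open>D\<close>.\<close>

lemma defect_solution_if_eigenvalue:
  assumes ext': "unitary_extension U' D V" and eig: "eigenvalue U' \<gamma>" and \<gamma>: "cmod \<gamma> = 1"
  shows "\<exists>\<kappa> x. defect_solution U \<psi> \<gamma> \<kappa> x"
proof -
  have U': "unitary U'" and eq: "\<And>d. cinner d \<psi> = 0 \<Longrightarrow> U' d = U d"
    using ext' V_eq_U by (auto simp: unitary_extension_def in_D_iff)
  obtain x where x: "x \<noteq> 0" "U' x = \<gamma> *\<^sub>C x"
    using eig by (auto simp: eigenvalue_def)
  have ne: "cinner x \<psi> \<noteq> 0"
    using no_eigenvector[of x \<gamma>] x \<gamma> eq[of x] by auto
  have "cinner d (inv U (U' \<psi>)) = 0" if d: "cinner d \<psi> = 0" for d
  proof -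
    have "cinner d (inv U (U' \<psi>)) = cinner (U d) (U' \<psi>)"
      using unitary_cinner[OF U, of d "inv U (U' \<psi>)"] by (simp add: unitary_inverse[OF U])
    also have "\<dots> = 0"
      using unitary_cinner[OF U', of d \<psi>] eq[OF d] d by simp
    finally show ?thesis .
  qed
  then obtain \<kappa> where "inv U (U' \<psi>) = \<kappa> *\<^sub>C \<psi>"
    using orth_D_ex by blast
  then have U'\<psi>: "U' \<psi> = \<kappa> *\<^sub>C U \<psi>"
    by (metis U unitary_inverse(1) unitary_scaleC)
  \<comment> \<open>Splitting off the component along \<open>\<psi>\<close> leaves a vector on which
    \<open>U\<close> and \<open>U'\<close> agree.\<close>
  define a where "a = cinner x \<psi> / cinner \<psi> \<psi>"
  have "cinner (x - a *\<^sub>C \<psi>) \<psi> = 0"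
    using \<psi> by (simp add: a_def cinner_simps cinner_eq_zero_iff)
  from eq[OF this] have "U x = U' x - U' (a *\<^sub>C \<psi>) + U (a *\<^sub>C \<psi>)"
    by (simp add: unitary_diff[OF U] unitary_diff[OF U'] algebra_simps)
  also have "\<dots> = \<gamma> *\<^sub>C x + (a - a * \<kappa>) *\<^sub>C U \<psi>"
    by (simp add: x unitary_scaleC[OF U] unitary_scaleC[OF U'] U'\<psi> scaleC_scaleC
        scaleC.scale_left_diff_distrib)
  finally show ?thesis
    using defect_solution_scale[OF U _ ne] by blast
qed

text \<open>The extension sending \<open>\<psi>\<close> to
  \<open>\<kappa> *\<^sub>C U \<psi>\<close> is \<open>U\<close> after \<open>S \<kappa>\<close>. It
  is unitary because \<open>\<kappa>\<close> is unimodular, with \<open>S (cnj \<kappa>)\<close> as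
  right inverse of \<open>S \<kappa>\<close>.\<close>

lemma eigenvalue_if_defect_solution:
  assumes \<gamma>: "cmod \<gamma> = 1" and x: "defect_solution U \<psi> \<gamma> \<kappa> x" and \<kappa>: "cmod \<kappa> = 1"
  shows "\<exists>U'. unitary_extension U' D V \<and> eigenvalue U' \<gamma>"
proof (intro exI conjI)
  define p where "p y = cinner y \<psi> / cinner \<psi> \<psi>" for y
  have N: "cinner \<psi> \<psi> \<noteq> 0" using \<psi> by (simp add: cinner_eq_zero_iff)
  have p_add: "p (y + z) = p y + p z" and p_scale: "p (c *\<^sub>C y) = c * p y" and p_\<psi>: "p \<psi> = 1" for y z c
    using N by (simp_all add: p_def cinner_simps add_divide_distrib)
  \<comment> \<open>\<open>S \<eta>\<close> multiplies the component along \<open>\<psi>\<close> by \<open>\<eta>\<close>\<close>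
  define S where "S \<eta> y = y + (p y * (\<eta> - 1)) *\<^sub>C \<psi>" for \<eta> y
  have S_norm: "norm (S \<eta> y) = norm y" if "cmod \<eta> = 1" for \<eta> y
  proof -
    have py: "cinner y \<psi> = p y * cinner \<psi> \<psi>"
      using N by (simp add: p_def)
    have py': "cinner \<psi> y = cnj (p y) * cinner \<psi> \<psi>"
      using cinner_commute[of \<psi> y] cinner_commute[of \<psi> \<psi>] unfolding py by simp
    have "cinner (S \<eta> y) (S \<eta> y) = cinner y y + p y * cnj (p y) * cinner \<psi> \<psi> * (\<eta> * cnj \<eta> - 1)"
      unfolding S_def by (simp add: cinner_simps py py') (simp add: algebra_simps)
    then have "complex_of_real ((norm (S \<eta> y))\<^sup>2) = of_real ((norm y)\<^sup>2)"
      by (simp only: cinner_self cmod_unit_mult_cnj[OF that]) simp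
    then show ?thesis by (simp only: of_real_eq_iff power2_eq_iff_nonneg norm_ge_zero)
  qed
  have S_S: "S \<kappa> (S (cnj \<kappa>) y) = y" for y
  proof -
    have "S \<kappa> (S (cnj \<kappa>) y) = y + (p y * (\<kappa> * cnj \<kappa> - 1)) *\<^sub>C \<psi>"
      by (simp add: S_def p_add p_scale p_\<psi> flip: scaleC_add_left) (simp add: algebra_simps flip: scaleC_add_left)
    then show ?thesis by (simp add: cmod_unit_mult_cnj[OF \<kappa>])
  qed
  let ?U' = "\<lambda>y. U (S \<kappa> y)"
  have "unitary ?U'"
    unfolding unitary_def
  proof (intro conjI allI)
    show "?U' (y + z) = ?U' y + ?U' z" for y z
      by (simp add: S_def p_add distrib_right scaleC_add_left add_ac flip: unitary_add[OF U])
    show "?U' (c *\<^sub>C y) = c *\<^sub>C ?U' y" for c y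
      by (simp add: S_def p_scale scaleC_add_right scaleC_scaleC mult.assoc flip: unitary_scaleC[OF U])
    show "norm (?U' y) = norm y" for y
      by (simp add: unitary_norm[OF U] S_norm[OF \<kappa>])
    show "surj ?U'"
    proof (rule surjI)
      show "?U' (S (cnj \<kappa>) (inv U y)) = y" for y
        by (simp add: S_S unitary_inverse[OF U])
    qed
  qed
  then show "unitary_extension ?U' D V"
    by (auto simp: unitary_extension_def in_D_iff V_eq_U S_def p_def)
  have px: "p x = 1" using x N by (simp add: p_def defect_solution_def)
  have "?U' x = U x + (\<kappa> - 1) *\<^sub>C U \<psi>"
    by (simp add: S_def px unitary_add[OF U] unitary_scaleC[OF U])
  also have "\<dots> = \<gamma> *\<^sub>C x"
    using x by (simp add: defect_solution_def add.assoc flip: scaleC_add_left)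
  finally have "?U' x = \<gamma> *\<^sub>C x" .
  moreover have "x \<noteq> 0" using px by (auto simp: p_def)
  ultimately show "eigenvalue ?U' \<gamma>" by (auto simp: eigenvalue_def)
qed

text \<open>The domain is the range of \<open>1 - V\<close>. A solution at 1 is a nonzero vector
  orthogonal to it. Conversely, for \<open>v\<close> orthogonal to this range,
  \<open>v - inv U v\<close> is orthogonal to \<open>D\<close>, hence a multiple of
  \<open>\<psi>\<close>; applying \<open>U\<close> gives the defect equation up to scaling.\<close>

lemma densely_defined_inv_cayley_graph_iff:
  "densely_defined (inv_cayley_graph D V) \<longleftrightarrow> \<not> (\<exists>\<kappa> x. defect_solution U \<psi> 1 \<kappa> x)"
proof -
  define R where "R = (\<lambda>d. d - U d) ` D"
  have "Domain (inv_cayley_graph D V) = R"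
    unfolding R_def inv_cayley_graph_def by (force simp: V_eq_U in_D_iff)
  then have dense: "densely_defined (inv_cayley_graph D V) \<longleftrightarrow> closure R = UNIV"
    by (simp add: densely_defined_def)
  have R: "csubspace R"
    unfolding csubspace_def
  proof (intro conjI ballI allI)
    have "U 0 = 0" using unitary_norm[OF U, of 0] by simp
    then show "0 \<in> R"
      unfolding R_def by (intro image_eqI[of _ _ 0]) (simp_all add: in_D_iff)
  next
    fix y z assume "y \<in> R" "z \<in> R"
    then obtain a b where "y = a - U a" "z = b - U b" "a \<in> D" "b \<in> D" by (auto simp: R_def)
    then show "y + z \<in> R"
      unfolding R_def by (intro image_eqI[of _ _ "a + b"]) (simp_all add: in_D_iff cinner_add_left unitary_add[OF U])
  next
    fix c y assume "y \<in> R"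
    then obtain a where "y = a - U a" "a \<in> D" by (auto simp: R_def)
    then show "c *\<^sub>C y \<in> R"
      unfolding R_def
      by (intro image_eqI[of _ _ "c *\<^sub>C a"])
        (simp_all add: in_D_iff cinner_scaleC_left unitary_scaleC[OF U] scaleC.scale_right_diff_distrib)
  qed
  have "False" if closure: "closure R = UNIV" and x: "defect_solution U \<psi> 1 \<kappa> x" for \<kappa> x
  proof -
    have "cinner r x = 0" if r: "r \<in> R" for r
    proof -
      obtain d where d: "r = d - U d" "cinner d \<psi> = 0"
        using r by (auto simp: R_def in_D_iff)
      have "cinner d x = cinner (U d) (U x)"
        by (simp add: unitary_cinner[OF U])
      also have "U x = x + (1 - \<kappa>) *\<^sub>C U \<psi>"
        using x by (simp add: defect_solution_def scaleC_one)
      finally show ?thesis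
        using d by (simp add: cinner_simps unitary_cinner[OF U])
    qed
    then have "R \<subseteq> {r. cinner r x = 0}" by blast
    moreover have "closed {r. cinner r x = 0}"
      by (intro closed_Collect_eq linear_continuous_on bounded_linear_cinner_left continuous_on_const)
    ultimately have "closure R \<subseteq> {r. cinner r x = 0}" by (rule closure_minimal)
    then have "cinner x x = 0" using closure by blast
    then have "x = 0" by (simp add: cinner_eq_zero_iff)
    then show False using x \<psi> by (simp add: defect_solution_def cinner_eq_zero_iff)
  qed
  moreover have "\<exists>\<kappa> x. defect_solution U \<psi> 1 \<kappa> x" if "closure R \<noteq> UNIV"
  proof -
    obtain y where y: "y \<notin> closure R" using \<open>closure R \<noteq> UNIV\<close> by blast
    obtain q where q: "q \<in> closure R" "y - q \<in> orth R"
      using csubspace_projection[OF R] .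
    define v where "v = y - q"
    have v0: "v \<noteq> 0" using q(1) y by (auto simp: v_def)
    have "cinner d (v - inv U v) = 0" if d: "cinner d \<psi> = 0" for d
    proof -
      have "cinner (d - U d) v = 0"
        using q(2) d by (auto simp: orth_def v_def R_def in_D_iff)
      moreover have "cinner d (inv U v) = cinner (U d) v"
        using unitary_cinner[OF U, of d "inv U v"] by (simp add: unitary_inverse[OF U])
      ultimately show ?thesis by (simp add: cinner_simps)
    qed
    then obtain c where "v - inv U v = c *\<^sub>C \<psi>"
      using orth_D_ex by blast
    then have "U v - U (inv U v) = c *\<^sub>C U \<psi>"
      by (metis U unitary_diff unitary_scaleC)
    then have Uv: "U v = v + c *\<^sub>C U \<psi>"
      by (simp add: unitary_inverse[OF U] algebra_simps)
    \<comment> \<open>If \<open>v\<close> were orthogonal to \<open>\<psi>\<close>, comparing the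
      norms of \<open>v - c *\<^sub>C \<psi>\<close> and its image \<open>v\<close> would force
      \<open>c *\<^sub>C \<psi> = 0\<close>, making \<open>v\<close> a nonzero fixed vector of
      \<open>U\<close> in \<open>D\<close>.\<close>
    have ne: "cinner v \<psi> \<noteq> 0"
    proof
      assume 0: "cinner v \<psi> = 0"
      have "U (v - c *\<^sub>C \<psi>) = v"
        by (simp add: unitary_diff[OF U] unitary_scaleC[OF U] Uv)
      then have "(norm (v - c *\<^sub>C \<psi>))\<^sup>2 = (norm v)\<^sup>2"
        by (metis U unitary_norm)
      then have "c *\<^sub>C \<psi> = 0"
        using 0 by (simp add: norm_diff_sq cinner_scaleC_right)
      then have "U v = 1 *\<^sub>C v"
        using \<psi> Uv by (auto simp: scaleC_one)
      from no_eigenvector[OF 0 this] show False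
        using v0 by simp
    qed
    have "U v = 1 *\<^sub>C v + c *\<^sub>C U \<psi>"
      using Uv by (simp add: scaleC_one)
    from defect_solution_scale[OF U this ne] show ?thesis .
  qed
  ultimately show ?thesis unfolding dense by blast
qed

end

theorem theorem6:
  fixes D :: "'a::chilbert_space set" and V :: "'a \<Rightarrow> 'a"
    and U0 :: "'a \<Rightarrow> 'a" and \<psi> :: 'a
  assumes "isometric_lt D V"
    and "deficiency_1_1 D V"
    and "simple_isometric D V"
    and "unitary_extension U0 D V"
    and "\<psi> \<in> orth D" and "\<psi> \<noteq> 0"
  shows "(\<forall>z. norm z = 1 \<longrightarrow>
            ((\<forall>U. unitary_extension U D V \<longrightarrow> \<not> eigenvalue U z) \<longleftrightarrow>
             \<not> has_angular_derivative (char_fun U0 \<psi>) z))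
       \<and> (densely_defined (inv_cayley_graph D V) \<longleftrightarrow>
             \<not> has_angular_derivative (char_fun U0 \<psi>) 1)"
proof -
  have "orth D = range (\<lambda>c. c *\<^sub>C \<psi>)"
    using assms(2,5,6) by (intro one_dimensional_eq_range) (simp_all add: deficiency_1_1_def)
  then interpret simple_isometry_extension D V U0 \<psi>
    using assms by unfold_locales
  obtain X Y where "characteristic_family U0 \<psi> (char_fun U0 \<psi>) X Y"
    using characteristic_family_char_fun[OF U \<psi>] .
  then interpret characteristic_family U0 \<psi> "char_fun U0 \<psi>" X Y .
  have ang: "has_angular_derivative (char_fun U0 \<psi>) z \<longleftrightarrow> (\<exists>\<kappa> x. defect_solution U0 \<psi> z \<kappa> x)"
    if "cmod z = 1" for z
    using defect_solution_if_has_angular_derivative[OF that]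
      has_angular_derivative_if_defect_solution[OF that] no_eigenvector[OF _ _ that] by blast
  have eig: "(\<exists>U. unitary_extension U D V \<and> eigenvalue U z) \<longleftrightarrow> (\<exists>\<kappa> x. defect_solution U0 \<psi> z \<kappa> x)"
    if "cmod z = 1" for z
    using defect_solution_if_eigenvalue[OF _ _ that] eigenvalue_if_defect_solution[OF that]
      boundary_value_unimodular[OF that] by blast
  show ?thesis
  proof (intro conjI allI impI)
    fix z :: complex assume "norm z = 1"
    then show "(\<forall>U. unitary_extension U D V \<longrightarrow> \<not> eigenvalue U z) \<longleftrightarrow>
        \<not> has_angular_derivative (char_fun U0 \<psi>) z"
      using ang[of z] eig[of z] by blast
  next
    show "densely_defined (inv_cayley_graph D V) \<longleftrightarrow> \<not> has_angular_derivative (char_fun U0 \<psi>) 1"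
      unfolding densely_defined_inv_cayley_graph_iff using ang[of 1] by simp
  qed
qed

end
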